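(* For each $p\in\mathbb{N}$ consider the grid road network with vertex set $\mathcal{V}_p=\{0,\dots,p\}^2$ and segment set $\mathcal{S}_p$ of directed edges between vertices at $\ell_1$-distance $1$; $\mathcal{Y}_p$ is the set of possible routes (each a set of at least one segment). Let $0<\alpha\le1$ and let the route distribution $\mu_p$ be: origin $x_1$ and destination $x_2$ independent, each with $\mathbb{P}[X=(i,j)]=\prod_{k\in\{i,j\}}\binom{p}{k}B(\alpha+k,\alpha+p-k)/B(\alpha,\alpha)$; given $(x_1,x_2)$ the route is drawn uniformly among the routes from $x_1$ to $x_2$ whose number of segments equals $\|x_1-x_2\|_1$ and which have the minimum possible number of turns. The $N=N(p)\to\infty$ historical routes and the predicting route $Y_p$ are i.i.d. from $\mu_p$. For each trip $n$ and segment $s$ of its route, $T'_{n,s}=\theta_s+\varepsilon_{n,s}$, where the $\theta_s$ are i.i.d. with mean $\mu$ and variance $\tau^2>0$; within a trip the errors have mean $0$ and covariance $\sigma_{s,t}$; errors of distinct trips are independent; and the errors together with $\theta$ are jointly Gaussian. The matrices $\Sigma_p=[\sigma_{s,t}]_{s,t\in\mathcal{S}_p}$ and $\Psi_p=\Sigma_p^{-1}=[\psi_{s,t}]$ satisfy $\sum_{t}|\sigma_{s,t}|=\mathcal{O}(1)$ and $\sum_t|\psi_{s,t}|=\mathcal{O}(1)$ uniformly in $s$ and $p$, and there is $\sigma_{\min}>0$ with $\sum_{s,t\in y}\sigma_{s,t}\ge\sigma_{\min}$ for every route $y\in\mathcal{Y}_p$. (1) If $1/2\le\alpha\le1$ and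 $N=\omega(p)$, then for any segment-based estimator $\hat\Theta^{(\mathrm{seg})}$ with $\phi_s(N_s)=1-\mathcal{O}(1/\sqrt{N_s})$ for all $s\in\mathcal{S}_p$, $$\frac{R(\hat\Theta^{(\mathrm{seg})}_{Y_p})}{R(\hat\Theta^\ast_{Y_p})}=\mathcal{O}(\log p),$$ where $\hat\Theta^\ast_{Y_p}$ is the optimal (integrated-risk-minimizing) estimator. (2) If $N=\mathcal{O}(p)$, then $\liminf_{p\to\infty}R(\hat\Theta_{Y_p})>0$ for any estimator $\hat\Theta$.
   Context: $B(\cdot,\cdot)$ is the beta function. Integrated risk: $R(\hat\Theta_{Y_p})=\mathbb{E}[(\hat\Theta_{Y_p}-\sum_{s\in Y_p}\theta_s)^2]$, expectation over historical routes, predicting route, travel times and the prior of $\theta$. The optimal estimator $\hat\Theta^\ast_{Y_p}$ is the posterior mean of $\sum_{s\in Y_p}\theta_s$ given all observed historical travel times and routes. $N_s$ is the number of historical trips traversing $s$; convention $0/0=0$. A segment-based estimator for route $y$ is $\sum_{s\in y}[(1-\phi_s(N_s))\mu+\phi_s(N_s)\sum_{n:s\in Y_{p,n}}T'_{n,s}/N_s]$ with $\phi_s:\mathbb{Z}_{\ge0}\to\mathbb{R}$, $\phi_s(0)=0$. $\mathcal{O},\Omega,\omega$ are the usual asymptotic notations as $p\to\infty$.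
   Formalization: The origin and destination are conditioned to be distinct: as stated they coincide with positive probability, and then no route with at least one segment and length ‖x₁−x₂‖₁ = 0 exists, so the route distribution is undefined. *)

theory Defs
  imports "HOL-Probability.Probability" "HOL-Library.Landau_Symbols"
begin

type_synonym vtx = "nat \<times> nat"
type_synonym seg = "vtx \<times> vtx"

definition ndiff :: "nat \<Rightarrow> nat \<Rightarrow> nat" where
  "ndiff x y = (if x \<le> y then y - x else x - y)"

definition l1 :: "vtx \<Rightarrow> vtx \<Rightarrow> nat" where
  "l1 a b = ndiff (fst a) (fst b) + ndiff (snd a) (snd b)"

definition vertices :: "nat \<Rightarrow> vtx set" where
  "vertices p = {0..p} \<times> {0..p}"

definition segments :: "nat \<Rightarrow> seg set" where
  "segments p = {(u, v). u \<in> vertices p \<and> v \<in> vertices p \<and> l1 u v = 1}"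

definition edges :: "vtx list \<Rightarrow> seg list" where
  "edges vs = zip vs (tl vs)"

definition dir :: "seg \<Rightarrow> int \<times> int" where
  "dir e = (int (fst (snd e)) - int (fst (fst e)), int (snd (snd e)) - int (snd (fst e)))"

definition turns :: "vtx list \<Rightarrow> nat" where
  "turns vs = card {i. Suc i < length (edges vs) \<and> dir (edges vs ! i) \<noteq> dir (edges vs ! Suc i)}"

definition shortest_paths :: "nat \<Rightarrow> vtx \<Rightarrow> vtx \<Rightarrow> vtx list set" where
  "shortest_paths p a b = {vs. vs \<noteq> [] \<and> hd vs = a \<and> last vs = b \<and>
      set (edges vs) \<subseteq> segments p \<and> length (edges vs) = l1 a b}"

definition min_turn_routes :: "nat \<Rightarrow> vtx \<Rightarrow> vtx \<Rightarrow> seg set set" where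
  "min_turn_routes p a b =
     (\<lambda>vs. set (edges vs)) `
       {vs \<in> shortest_paths p a b. \<forall>ws \<in> shortest_paths p a b. turns vs \<le> turns ws}"

definition routes :: "nat \<Rightarrow> seg set set" where
  "routes p = (\<Union>a \<in> vertices p. \<Union>b \<in> vertices p. if a \<noteq> b then min_turn_routes p a b else {})"

definition betabin_pmf :: "real \<Rightarrow> nat \<Rightarrow> nat pmf" where
  "betabin_pmf \<alpha> p = embed_pmf (\<lambda>k. if k \<le> p then
      real (p choose k) * Beta (\<alpha> + real k) (\<alpha> + real p - real k) / Beta \<alpha> \<alpha> else 0)"

definition vertex_pmf :: "real \<Rightarrow> nat \<Rightarrow> vtx pmf" where
  "vertex_pmf \<alpha> p = pair_pmf (betabin_pmf \<alpha> p) (betabin_pmf \<alpha> p)"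

text \<open>origin/destination independent (conditioned on being distinct, so that a route with
  at least one segment exists); then a uniformly chosen min-turn shortest route\<close>
definition route_pmf :: "real \<Rightarrow> nat \<Rightarrow> seg set pmf" where
  "route_pmf \<alpha> p =
     bind_pmf (cond_pmf (pair_pmf (vertex_pmf \<alpha> p) (vertex_pmf \<alpha> p)) {(a, b). a \<noteq> b})
       (\<lambda>(a, b). pmf_of_set (min_turn_routes p a b))"

definition gaussian_vec :: "seg set \<Rightarrow> (seg \<Rightarrow> seg \<Rightarrow> real) \<Rightarrow> (seg \<Rightarrow> real) measure \<Rightarrow> bool" where
  "gaussian_vec S C G \<longleftrightarrow> prob_space G \<and> sets G = sets (PiM S (\<lambda>_. borel)) \<and>
     (\<forall>c :: seg \<Rightarrow> real.
        let v = (\<Sum>s\<in>S. \<Sum>t\<in>S. c s * c t * C s t); L = (\<lambda>x. \<Sum>s\<in>S. c s * x s) in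
        v \<ge> 0 \<and>
        (v > 0 \<longrightarrow> distributed G lborel L (normal_density 0 (sqrt v))) \<and>
        (v = 0 \<longrightarrow> (AE x in G. L x = 0)))"

text \<open>Sample point: (historical routes, predicting route, theta, errors of historical trips)\<close>
type_synonym sample = "(nat \<Rightarrow> seg set) \<times> seg set \<times> (seg \<Rightarrow> real) \<times> (nat \<Rightarrow> seg \<Rightarrow> real)"

text \<open>Observed data: (historical routes, predicting route, observed travel times T'_{n,s})\<close>
type_synonym data = "(nat \<Rightarrow> seg set) \<times> seg set \<times> (nat \<Rightarrow> seg \<Rightarrow> real)"

definition model :: "real \<Rightarrow> nat \<Rightarrow> nat \<Rightarrow> real \<Rightarrow> real \<Rightarrow> (seg \<Rightarrow> real) measure \<Rightarrow> sample measure" where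
  "model \<alpha> p Nn \<mu> \<tau> G =
     PiM {..<Nn} (\<lambda>_. measure_pmf (route_pmf \<alpha> p)) \<Otimes>\<^sub>M
     (measure_pmf (route_pmf \<alpha> p) \<Otimes>\<^sub>M
     (PiM (segments p) (\<lambda>_. density lborel (normal_density \<mu> \<tau>)) \<Otimes>\<^sub>M
      PiM {..<Nn} (\<lambda>_. G)))"

definition data_space :: "nat \<Rightarrow> nat \<Rightarrow> data measure" where
  "data_space p Nn =
     PiM {..<Nn} (\<lambda>_. count_space UNIV) \<Otimes>\<^sub>M
     (count_space UNIV \<Otimes>\<^sub>M PiM {..<Nn} (\<lambda>_. PiM (segments p) (\<lambda>_. borel)))"

definition observe :: "nat \<Rightarrow> nat \<Rightarrow> sample \<Rightarrow> data" where
  "observe p Nn \<omega> = (case \<omega> of (yh, y, \<theta>, e) \<Rightarrow>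
     (restrict yh {..<Nn}, y,
      (\<lambda>n\<in>{..<Nn}. \<lambda>s\<in>segments p. if s \<in> yh n then \<theta> s + e n s else 0)))"

definition risk :: "real \<Rightarrow> nat \<Rightarrow> nat \<Rightarrow> real \<Rightarrow> real \<Rightarrow> (seg \<Rightarrow> real) measure \<Rightarrow> (data \<Rightarrow> real) \<Rightarrow> ennreal" where
  "risk \<alpha> p Nn \<mu> \<tau> G g =
     (\<integral>\<^sup>+ \<omega>. ennreal ((g (observe p Nn \<omega>) - (\<Sum>s\<in>fst (snd \<omega>). fst (snd (snd \<omega>)) s))\<^sup>2)
        \<partial>model \<alpha> p Nn \<mu> \<tau> G)"

definition opt_risk :: "real \<Rightarrow> nat \<Rightarrow> nat \<Rightarrow> real \<Rightarrow> real \<Rightarrow> (seg \<Rightarrow> real) measure \<Rightarrow> ennreal" where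
  "opt_risk \<alpha> p Nn \<mu> \<tau> G =
     (INF g \<in> borel_measurable (data_space p Nn). risk \<alpha> p Nn \<mu> \<tau> G g)"

definition hist_count :: "nat \<Rightarrow> (nat \<Rightarrow> seg set) \<Rightarrow> seg \<Rightarrow> nat" where
  "hist_count Nn yh s = card {n. n < Nn \<and> s \<in> yh n}"

definition seg_est :: "nat \<Rightarrow> real \<Rightarrow> (seg \<Rightarrow> nat \<Rightarrow> real) \<Rightarrow> data \<Rightarrow> real" where
  "seg_est Nn \<mu> \<phi> d = (case d of (yh, y, T) \<Rightarrow>
     (\<Sum>s\<in>y. (1 - \<phi> s (hist_count Nn yh s)) * \<mu> +
        \<phi> s (hist_count Nn yh s) *
          ((\<Sum>n\<in>{n. n < Nn \<and> s \<in> yh n}. T n s) / real (hist_count Nn yh s))))"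

end

theory Submission
  imports Defs
begin

text \<open>
  Fix the historical routes and the predicting route \<open>y\<close>, and let \<open>N\<^sub>s\<close> count the trips through
  the segment \<open>s\<close>. Up to constant factors, both the risk of a segment-based estimator and the
  smallest possible risk are then equal to \<open>\<Sum>s\<in>y. 1 / (1 + N\<^sub>s)\<close>; in particular the ratio in part (1)
  is bounded.

  The upper bound holds because the error of the estimator is linear in the centred Gaussian
  variables, and a quadratic form is bounded by its absolute row sums times the squared norm.

  For the lower bound let \<open>V = \<Sum>s. a\<^sub>s (\<theta>\<^sub>s - \<mu>) + \<Sum>n. b\<^sub>n \<bullet> \<epsilon>\<^sub>n\<close> with \<open>b\<^sub>n = - \<tau>\<^sup>2 \<Psi> (a 1\<^sub>Y\<^sub>n)\<close>. It is
  uncorrelated with every observed travel time, hence orthogonal to every function of the data, and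
  its variance is at most \<open>\<Sum>s. a\<^sub>s\<^sup>2 (\<tau>\<^sup>2 + \<tau>\<^sup>4 C N\<^sub>s)\<close>. Expanding the square of estimation error plus
  \<open>\<tau>\<^sup>2 V\<close> for the optimal \<open>a\<close> gives the bound. That uncorrelated implies orthogonal for Gaussian
  vectors given only by their one-dimensional projections follows from Levy's uniqueness theorem,
  applied one coordinate at a time.

  For part (2), Jensen's inequality bounds the expectation of \<open>\<Sum>s\<in>Y. 1 / (1 + N\<^sub>s)\<close> from below by
  \<open>\<Sum>s. p\<^sub>s / (1 + N p\<^sub>s)\<close>, where \<open>p\<^sub>s\<close> is the probability that a route traverses \<open>s\<close>. Beta-binomial weights
  are at least \<open>\<alpha>\<^sup>2 / (p + 1)\<close>, so straight routes alone make \<open>p\<^sub>s\<close> of order at least \<open>1 / p\<^sup>2\<close> for order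
  \<open>p\<^sup>2\<close> many segments.
\<close>

section \<open>Fourier uniqueness in several variables\<close>

lemma integrable_mult_iexp:
  fixes W :: "'a \<Rightarrow> complex"
  assumes "integrable M W" and [measurable]: "f \<in> borel_measurable M"
  shows "integrable M (\<lambda>x. W x * iexp (f x))"
proof -
  have [measurable]: "W \<in> borel_measurable M" using assms(1) by auto
  show ?thesis
    using assms(1) by (rule Bochner_Integration.integrable_bound) (auto simp: norm_mult)
qed

text \<open>At u = 0 the hypothesis says that the positive and negative parts of \<open>W\<close>
  have the same total mass. Normalised, they are the densities of two probability measures under
  which \<open>X\<close> has the same characteristic function, so Levy's theorem identifies the two
  laws of \<open>X\<close>.\<close>

lemma fourier_vanish_real:
  fixes W X :: "'a \<Rightarrow> real"
  assumes W: "integrable M W" and X[measurable]: "X \<in> borel_measurable M"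
    and zero: "\<And>u. (CLINT x|M. complex_of_real (W x) * iexp (u * X x)) = 0"
    and B[measurable]: "B \<in> sets borel"
  shows "(\<integral>x. W x * indicator B (X x) \<partial>M) = 0"
proof -
  have Wm[measurable]: "W \<in> borel_measurable M" using W by auto
  define P where "P x = max 0 (W x)" for x
  define Q where "Q x = max 0 (- W x)" for x
  have PQ: "W x = P x - Q x" "P x \<ge> 0" "Q x \<ge> 0" for x by (auto simp: P_def Q_def)
  have iP: "integrable M P" and iQ: "integrable M Q"
    unfolding P_def Q_def using W by auto
  have [measurable]: "P \<in> borel_measurable M" "Q \<in> borel_measurable M"
    using iP iQ by auto
  define m where "m = integral\<^sup>L M P"
  have "(\<integral>x. W x \<partial>M) = 0"
    using zero[of 0] by simp
  then have mQ: "integral\<^sup>L M Q = m"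
    using iP iQ by (simp add: PQ(1) m_def)
  show ?thesis
  proof (cases "m = 0")
    \<comment> \<open>Without mass no normalisation is possible, but then both parts, and with them
      \<open>W\<close>, vanish almost everywhere.\<close>
    case True
    have "AE x in M. P x = 0"
      using True iP PQ by (subst integral_nonneg_eq_0_iff_AE[symmetric]) (auto simp: m_def)
    moreover have "AE x in M. Q x = 0"
      using True mQ iQ PQ by (subst integral_nonneg_eq_0_iff_AE[symmetric]) auto
    ultimately have "AE x in M. W x * indicator B (X x) = 0"
      by eventually_elim (auto simp: PQ(1))
    then show ?thesis
      by (rule integral_eq_zero_AE)
  next
    case False
    moreover have "m \<ge> 0" unfolding m_def using PQ by auto
    ultimately have m: "m > 0" by simp
    have ps: "prob_space (density M (\<lambda>x. ennreal (R x / m)))"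
      if "integrable M R" "\<And>x. R x \<ge> 0" "integral\<^sup>L M R = m" for R
    proof (rule prob_spaceI)
      have [measurable]: "R \<in> borel_measurable M" using that by auto
      show "emeasure (density M (\<lambda>x. ennreal (R x / m))) (space (density M (\<lambda>x. ennreal (R x / m)))) = 1"
        using that m by (subst emeasure_density) (auto simp: nn_integral_eq_integral cong: nn_integral_cong_simp)
    qed
    interpret P: prob_space "density M (\<lambda>x. ennreal (P x / m))"
      by (rule ps) (use iP PQ in \<open>auto simp: m_def\<close>)
    interpret Q: prob_space "density M (\<lambda>x. ennreal (Q x / m))"
      by (rule ps) (use iQ PQ mQ in auto)
    have ch: "char (distr (density M (\<lambda>x. ennreal (R x / m))) borel X) t
              = (CLINT x|M. complex_of_real (R x) * iexp (t * X x)) / m"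
      if "integrable M R" "\<And>x. R x \<ge> 0" for R t
    proof -
      have [measurable]: "R \<in> borel_measurable M" using that by auto
      show ?thesis
        unfolding char_def using m that
        by (simp add: integral_distr integral_density scaleR_conv_of_real)
    qed
    have "(CLINT x|M. complex_of_real (P x) * iexp (t * X x)) = (CLINT x|M. complex_of_real (Q x) * iexp (t * X x))" for t
    proof -
      have "(CLINT x|M. complex_of_real (P x) * iexp (t * X x)) - (CLINT x|M. complex_of_real (Q x) * iexp (t * X x))
        = (CLINT x|M. complex_of_real (P x) * iexp (t * X x) - complex_of_real (Q x) * iexp (t * X x))"
        using iP iQ by (intro Bochner_Integration.integral_diff[symmetric] integrable_mult_iexp) auto
      also have "\<dots> = (CLINT x|M. complex_of_real (W x) * iexp (t * X x))"
        by (simp add: PQ(1) algebra_simps)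
      finally show ?thesis using zero[of t] by simp
    qed
    then have "char (distr (density M (\<lambda>x. ennreal (P x / m))) borel X)
        = char (distr (density M (\<lambda>x. ennreal (Q x / m))) borel X)"
      using iP iQ PQ by (intro ext) (simp add: ch)
    then have eq: "distr (density M (\<lambda>x. ennreal (P x / m))) borel X
        = distr (density M (\<lambda>x. ennreal (Q x / m))) borel X"
      by (intro Levy_uniqueness P.real_distribution_distr Q.real_distribution_distr) auto
    have int: "integral\<^sup>L (distr (density M (\<lambda>x. ennreal (R x / m))) borel X) (indicator B)
              = (\<integral>x. R x * indicator B (X x) \<partial>M) / m"
      if "integrable M R" "\<And>x. R x \<ge> 0" for R
    proof -
      have [measurable]: "R \<in> borel_measurable M" using that by auto
      show ?thesis
        using m that by (subst integral_distr) (auto simp: integral_density)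
    qed
    have "(\<integral>x. P x * indicator B (X x) \<partial>M) / m = (\<integral>x. Q x * indicator B (X x) \<partial>M) / m"
      using int[OF iP] int[OF iQ] PQ eq by simp
    then have 1: "(\<integral>x. P x * indicator B (X x) \<partial>M) = (\<integral>x. Q x * indicator B (X x) \<partial>M)"
      using m by simp
    have "integrable M (\<lambda>x. P x * indicator B (X x))"
      using iP by (rule Bochner_Integration.integrable_bound) (auto split: split_indicator)
    moreover have "integrable M (\<lambda>x. Q x * indicator B (X x))"
      using iQ by (rule Bochner_Integration.integrable_bound) (auto split: split_indicator)
    ultimately show ?thesis
      using 1 by (simp add: PQ(1) left_diff_distrib)
  qed
qed

text \<open>Complex weights are needed for the induction over coordinates, where exponentials of the
  other coordinates enter the weight. The transform of \<open>cnj W\<close> at u is the conjugate of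
  that of \<open>W\<close> at -u, so it vanishes as well; hence real and imaginary part both satisfy
  the real version.\<close>

lemma fourier_vanish_complex:
  fixes W :: "'a \<Rightarrow> complex" and X :: "'a \<Rightarrow> real"
  assumes W: "integrable M W" and X[measurable]: "X \<in> borel_measurable M"
    and zero: "\<And>u. (CLINT x|M. W x * iexp (u * X x)) = 0"
    and B[measurable]: "B \<in> sets borel"
  shows "(CLINT x|M. W x * indicator B (X x)) = 0"
proof -
  have Wm[measurable]: "W \<in> borel_measurable M" using W by auto
  have iR: "integrable M (\<lambda>x. Re (W x))" "integrable M (\<lambda>x. Im (W x))" using W by auto
  have conj: "(CLINT x|M. cnj (W x) * iexp (u * X x)) = 0" for u
  proof -
    have "(CLINT x|M. cnj (W x) * iexp (u * X x)) = (CLINT x|M. cnj (W x * iexp ((-u) * X x)))"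
      by (intro Bochner_Integration.integral_cong) (auto simp: exp_cnj)
    also have "\<dots> = 0"
      using zero[of "-u"] by (simp only: Bochner_Integration.integral_cnj) simp
    finally show ?thesis .
  qed
  have Wi: "integrable M (\<lambda>x. W x * iexp (u * X x))" for u
    using W by (rule integrable_mult_iexp) auto
  have Wci: "integrable M (\<lambda>x. cnj (W x) * iexp (u * X x))" for u
    by (rule integrable_mult_iexp) (use W in auto)
  have "(\<integral>x. Re (W x) * indicator B (X x) \<partial>M) = 0"
  proof (rule fourier_vanish_real[OF iR(1) X _ B])
    fix u
    have "(CLINT x|M. complex_of_real (Re (W x)) * iexp (u * X x))
       = (CLINT x|M. (W x * iexp (u * X x) + cnj (W x) * iexp (u * X x)) / 2)"
      by (intro Bochner_Integration.integral_cong) (auto simp: complex_add_cnj simp flip: distrib_right)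
    also have "\<dots> = 0"
      using Wi Wci zero conj by simp
    finally show "(CLINT x|M. complex_of_real (Re (W x)) * iexp (u * X x)) = 0" .
  qed
  moreover have "(\<integral>x. Im (W x) * indicator B (X x) \<partial>M) = 0"
  proof (rule fourier_vanish_real[OF iR(2) X _ B])
    fix u
    have im: "complex_of_real (Im z) * e = (z * e - cnj z * e) / (2 * \<i>)" for z e
    proof -
      have "z * e - cnj z * e = (2 * \<i>) * (complex_of_real (Im z) * e)"
        by (simp add: complex_diff_cnj flip: left_diff_distrib)
      then show ?thesis
        by (simp only:) (rule nonzero_mult_div_cancel_left[symmetric], simp)
    qed
    have "(CLINT x|M. complex_of_real (Im (W x)) * iexp (u * X x))
       = (CLINT x|M. (W x * iexp (u * X x) - cnj (W x) * iexp (u * X x)) / (2 * \<i>))"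
      by (simp only: im)
    also have "\<dots> = 0"
      using Wi Wci zero conj by simp
    finally show "(CLINT x|M. complex_of_real (Im (W x)) * iexp (u * X x)) = 0" .
  qed
  moreover have i: "integrable M (\<lambda>x. W x * indicator B (X x))"
    using W by (rule Bochner_Integration.integrable_bound) (auto split: split_indicator)
  have "Re (CLINT x|M. W x * indicator B (X x)) = (\<integral>x. Re (W x) * indicator B (X x) \<partial>M)"
       "Im (CLINT x|M. W x * indicator B (X x)) = (\<integral>x. Im (W x) * indicator B (X x) \<partial>M)"
    using i by (auto simp flip: integral_Re integral_Im intro!: Bochner_Integration.integral_cong split: split_indicator)
  ultimately show ?thesis
    by (intro complex_eqI) auto
qed

text \<open>Induction on \<open>I\<close> with arbitrary \<open>Z\<close>. For fixed coefficients of
  the other coordinates, \<open>Z\<close> times their exponential is a weight whose transform in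
  \<open>X j\<close> vanishes. So this weight may be multiplied by the indicator of
  \<open>B j\<close>, and \<open>Z\<close> times that indicator satisfies the hypothesis for the
  remaining coordinates.\<close>

lemma fourier_vanish_rectangle:
  fixes X :: "'i \<Rightarrow> 'a \<Rightarrow> real"
  assumes "finite I" and "\<And>i. i \<in> I \<Longrightarrow> X i \<in> borel_measurable M"
    and "integrable M (Z :: 'a \<Rightarrow> complex)"
    and "\<And>c. (CLINT x|M. Z x * iexp (\<Sum>i\<in>I. c i * X i x)) = 0"
    and "\<And>i. i \<in> I \<Longrightarrow> B i \<in> sets borel"
  shows "(CLINT x|M. Z x * (\<Prod>i\<in>I. indicator (B i) (X i x))) = 0"
  using assms
proof (induction I arbitrary: Z rule: finite_induct)
  case (insert j I)
  note [measurable] = insert.prems(1)[of j, simplified] insert.prems(4)[of j, simplified]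
  have [measurable]: "(\<lambda>x. \<Sum>i\<in>I. c i * X i x) \<in> borel_measurable M" for c
    using insert.prems(1) by (intro borel_measurable_sum borel_measurable_times) auto
  have [measurable]: "Z \<in> borel_measurable M" using insert.prems(2) by auto
  have Zi: "integrable M (\<lambda>x. Z x * indicator (B j) (X j x))"
    using insert.prems(2) by (rule Bochner_Integration.integrable_bound) (auto split: split_indicator)
  have "(CLINT x|M. (Z x * indicator (B j) (X j x)) * (\<Prod>i\<in>I. indicator (B i) (X i x))) = 0"
  proof (rule insert.IH[OF _ Zi])
    fix c
    have "(CLINT x|M. (Z x * iexp (\<Sum>i\<in>I. c i * X i x)) * indicator (B j) (X j x)) = 0"
    proof (rule fourier_vanish_complex)
      show "integrable M (\<lambda>x. Z x * iexp (\<Sum>i\<in>I. c i * X i x))"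
        using insert.prems(2) by (rule integrable_mult_iexp) auto
      fix u
      \<comment> \<open>The frequency of coordinate \<open>j\<close> can be set to u without
        changing the rest of the sum, as \<open>j\<close> is not in \<open>I\<close>.\<close>
      have "(\<Sum>i\<in>I. (c(j := u)) i * X i x) = (\<Sum>i\<in>I. c i * X i x)" for x
        using insert.hyps by (intro sum.cong) auto
      then show "(CLINT x|M. Z x * iexp (\<Sum>i\<in>I. c i * X i x) * iexp (u * X j x)) = 0"
        using insert.prems(3)[of "c(j := u)"] insert.hyps
        by (simp add: algebra_simps exp_add del: fun_upd_apply of_real_sum) (simp add: algebra_simps)
    qed auto
    then show "(CLINT x|M. Z x * indicator (B j) (X j x) * iexp (\<Sum>i\<in>I. c i * X i x)) = 0"
      by (simp add: mult_ac)
  qed (use insert.prems in auto)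
  then show ?case
    using insert.hyps by (simp add: mult_ac)
qed simp

text \<open>The positive and negative parts of \<open>V\<close>, taken as densities and pushed
  forward by the vector of the \<open>X i\<close>, are finite measures that agree on rectangles.
  They therefore agree on the whole product \<sigma>-algebra and integrate \<open>k\<close> to the
  same value.\<close>

lemma fourier_vanish:
  fixes X :: "'i \<Rightarrow> 'a \<Rightarrow> real" and V :: "'a \<Rightarrow> real"
  assumes I: "finite I" and X[measurable]: "\<And>i. i \<in> I \<Longrightarrow> X i \<in> borel_measurable M"
    and V: "integrable M V"
    and zero: "\<And>c. (CLINT x|M. complex_of_real (V x) * iexp (\<Sum>i\<in>I. c i * X i x)) = 0"
    and k[measurable]: "k \<in> borel_measurable (PiM I (\<lambda>_. borel))"
    and Vk: "integrable M (\<lambda>x. V x * k (\<lambda>i\<in>I. X i x))"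
  shows "(\<integral>x. V x * k (\<lambda>i\<in>I. X i x) \<partial>M) = (0::real)"
proof -
  have [measurable]: "V \<in> borel_measurable M" using V by auto
  have XX[measurable]: "(\<lambda>x. \<lambda>i\<in>I. X i x) \<in> measurable M (PiM I (\<lambda>_. borel))"
    by (rule measurable_restrict) (use X in auto)
  define P where "P x = max 0 (V x)" for x
  define Q where "Q x = max 0 (- V x)" for x
  have PQ: "V x = P x - Q x" "P x \<ge> 0" "Q x \<ge> 0" for x by (auto simp: P_def Q_def)
  have iP: "integrable M P" and iQ: "integrable M Q"
    unfolding P_def Q_def using V by auto
  have [measurable]: "P \<in> borel_measurable M" "Q \<in> borel_measurable M"
    using iP iQ by auto
  let ?D = "\<lambda>R. distr (density M (\<lambda>x. ennreal (R x))) (PiM I (\<lambda>_. borel)) (\<lambda>x. \<lambda>i\<in>I. X i x)"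
  have em: "emeasure (?D R) A = ennreal (\<integral>x. R x * indicator A (\<lambda>i\<in>I. X i x) \<partial>M)"
    if R: "integrable M R" "\<And>x. R x \<ge> 0" and A[measurable]: "A \<in> sets (PiM I (\<lambda>_. borel))" for R A
  proof -
    have [measurable]: "R \<in> borel_measurable M" using R by auto
    have "integrable M (\<lambda>x. R x * indicator A (\<lambda>i\<in>I. X i x))"
      using R(1) by (rule Bochner_Integration.integrable_bound) (auto split: split_indicator)
    then have "ennreal (\<integral>x. R x * indicator A (\<lambda>i\<in>I. X i x) \<partial>M)
        = (\<integral>\<^sup>+x. ennreal (R x * indicator A (\<lambda>i\<in>I. X i x)) \<partial>M)"
      using R by (intro nn_integral_eq_integral[symmetric]) auto
    also have "\<dots> = emeasure (?D R) A"
      by (subst emeasure_distr)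
         (auto simp: emeasure_density intro!: nn_integral_cong split: split_indicator)
    finally show ?thesis by simp
  qed
  have eq: "?D P = ?D Q"
  proof (rule measure_eqI_PiM_finite[OF I])
    fix A :: "'i \<Rightarrow> real set" assume A: "\<And>i. i \<in> I \<Longrightarrow> A i \<in> sets borel"
    have S: "Pi\<^sub>E I A \<in> sets (PiM I (\<lambda>_. borel))"
      using A I by (intro sets_PiM_I_finite) auto
    note [measurable] = S
    have ind: "indicator (Pi\<^sub>E I A) (\<lambda>i\<in>I. X i x) = (\<Prod>i\<in>I. indicator (A i) (X i x) :: real)" for x
    proof (cases "\<forall>i\<in>I. X i x \<in> A i")
      case False
      then have "(\<Prod>i\<in>I. indicator (A i) (X i x) :: real) = 0"
        using I by (intro prod_zero) (auto simp: indicator_def)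
      with False show ?thesis by (auto simp: PiE_iff)
    qed (auto simp: PiE_iff)
    have "(CLINT x|M. complex_of_real (V x) * (\<Prod>i\<in>I. indicator (A i) (X i x))) = 0"
      by (rule fourier_vanish_rectangle[OF I X]) (use V zero A in auto)
    also have "(\<lambda>x. complex_of_real (V x) * (\<Prod>i\<in>I. indicator (A i) (X i x)))
      = (\<lambda>x. complex_of_real (V x * indicator (Pi\<^sub>E I A) (\<lambda>i\<in>I. X i x)))"
      unfolding ind by (auto simp: fun_eq_iff indicator_def of_bool_def if_distrib cong: if_cong)
    finally have z: "(\<integral>x. V x * indicator (Pi\<^sub>E I A) (\<lambda>i\<in>I. X i x) \<partial>M) = 0"
      by (simp only: integral_complex_of_real of_real_eq_0_iff)
    have "integrable M (\<lambda>x. P x * indicator (Pi\<^sub>E I A) (\<lambda>i\<in>I. X i x))"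
      using iP by (rule Bochner_Integration.integrable_bound) (auto split: split_indicator)
    moreover have "integrable M (\<lambda>x. Q x * indicator (Pi\<^sub>E I A) (\<lambda>i\<in>I. X i x))"
      using iQ by (rule Bochner_Integration.integrable_bound) (auto split: split_indicator)
    ultimately have "(\<integral>x. P x * indicator (Pi\<^sub>E I A) (\<lambda>i\<in>I. X i x) \<partial>M)
        = (\<integral>x. Q x * indicator (Pi\<^sub>E I A) (\<lambda>i\<in>I. X i x) \<partial>M)"
      using z by (simp add: PQ(1) left_diff_distrib)
    then show "emeasure (?D P) (Pi\<^sub>E I A) = emeasure (?D Q) (Pi\<^sub>E I A)"
      using em[OF iP _ S] em[OF iQ _ S] PQ by simp
  next
    \<comment> \<open>The measures are finite, so the whole space serves as a constant exhausting
      sequence.\<close>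
    show "range (\<lambda>_::nat. space (PiM I (\<lambda>_. borel))) \<subseteq> prod_algebra I (\<lambda>_. borel)"
      using I by (auto simp: space_PiM intro!: prod_algebraI_finite)
    show "emeasure (?D P) (space (PiM I (\<lambda>_. borel))) \<noteq> \<infinity>"
      using em[OF iP PQ(2)] by simp
  qed auto
  have int: "integral\<^sup>L (?D R) k = (\<integral>x. R x * k (\<lambda>i\<in>I. X i x) \<partial>M)"
    if R: "integrable M R" "\<And>x. R x \<ge> 0" for R
  proof -
    have [measurable]: "R \<in> borel_measurable M" using R by auto
    show ?thesis
      using R by (subst integral_distr) (auto simp: integral_density)
  qed
  have "integrable M (\<lambda>x. P x * k (\<lambda>i\<in>I. X i x))"
    using Vk by (rule Bochner_Integration.integrable_bound) (auto simp: P_def abs_mult intro!: mult_right_mono)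
  moreover have "integrable M (\<lambda>x. Q x * k (\<lambda>i\<in>I. X i x))"
    using Vk by (rule Bochner_Integration.integrable_bound) (auto simp: Q_def abs_mult intro!: mult_right_mono)
  moreover have "(\<integral>x. P x * k (\<lambda>i\<in>I. X i x) \<partial>M) = (\<integral>x. Q x * k (\<lambda>i\<in>I. X i x) \<partial>M)"
    using int[OF iP] int[OF iQ] PQ eq by simp
  ultimately show ?thesis
    by (simp add: PQ(1) left_diff_distrib)
qed

section \<open>Linear functionals of the Gaussian model\<close>

lemma (in prob_space) expectation_iexp_normal:
  assumes "distributed M lborel X (normal_density m s)" "0 < s"
  shows "(CLINT x|M. iexp (t * (X x - m))) = exp (- (t\<^sup>2 * s\<^sup>2) / 2)"
proof -
  have D: "distributed M lborel (\<lambda>x. (X x - m) / s) std_normal_density"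
    using assms normal_standard_normal_convert by blast
  then have m[measurable]: "(\<lambda>x. (X x - m) / s) \<in> borel_measurable M"
    by (auto dest: distributed_measurable)
  have "char std_normal_distribution (t * s) = char (distr M lborel (\<lambda>x. (X x - m) / s)) (t * s)"
    using D by (simp add: distributed_distr_eq_density)
  also have "\<dots> = (CLINT x|M. iexp (t * (X x - m)))"
    unfolding char_def using assms(2) by (subst integral_distr) auto
  finally show ?thesis
    by (simp add: char_std_normal_distribution power_mult_distrib)
qed

text \<open>The characteristic function determines the law: a point mass at 0 if
  \<open>v = 0\<close>, otherwise a standard normal law after division by \<open>sqrt v\<close>.
  Starting from the characteristic function covers degenerate functionals, which have no
  density.\<close>

lemma (in prob_space) has_bochner_integral_square_of_gaussian_char:
  fixes X :: "'a \<Rightarrow> real"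
  assumes X[measurable]: "X \<in> borel_measurable M" and v: "v \<ge> 0"
    and ch: "\<And>t. (CLINT x|M. iexp (t * X x)) = exp (- (t\<^sup>2 * v) / 2)"
  shows "has_bochner_integral M (\<lambda>x. (X x)\<^sup>2) v"
proof (cases "v = 0")
  case True
  interpret R: prob_space "return borel (0::real)"
    by (rule prob_space_return) auto
  have "distr M borel X = return borel 0"
  proof (rule Levy_uniqueness)
    show "real_distribution (return borel (0::real))"
      by (simp add: real_distribution_def real_distribution_axioms_def R.prob_space_axioms)
    show "char (distr M borel X) = char (return borel 0)"
      using ch True unfolding char_def by (intro ext) (simp add: integral_distr integral_return)
  qed auto
  moreover have "AE x in return borel (0::real). x = 0"
    by (subst AE_return) auto
  ultimately have "AE x in distr M borel X. x = 0"
    by (simp only:)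
  then have "AE x in M. X x = 0"
    by (subst (asm) AE_distr_iff) auto
  then have "AE x in M. (X x)\<^sup>2 = 0" by auto
  then have "has_bochner_integral M (\<lambda>x. (X x)\<^sup>2) 0"
    by (subst has_bochner_integral_cong_AE[where g="\<lambda>_. 0"]) auto
  with True show ?thesis by simp
next
  case False
  with v have v: "v > 0" by simp
  have eq: "distr M borel (\<lambda>x. X x / sqrt v) = std_normal_distribution"
  proof (rule Levy_uniqueness)
    show "char (distr M borel (\<lambda>x. X x / sqrt v)) = char std_normal_distribution"
    proof
      fix t
      show "char (distr M borel (\<lambda>x. X x / sqrt v)) t = char std_normal_distribution t"
        using ch[of "t / sqrt v"] v unfolding char_std_normal_distribution char_def
        by (simp add: integral_distr power_divide)
    qed
  qed (auto simp: real_dist_normal_dist)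
  have "integrable std_normal_distribution (\<lambda>x. x\<^sup>2)" "(\<integral>x. x\<^sup>2 \<partial>std_normal_distribution) = 1"
    using std_normal_distribution_even_moments[of 1] by auto
  then have "has_bochner_integral (distr M borel (\<lambda>x. X x / sqrt v)) (\<lambda>x. x\<^sup>2) 1"
    by (simp add: has_bochner_integral_iff eq)
  then have "has_bochner_integral M (\<lambda>x. (X x / sqrt v)\<^sup>2) 1"
    by (simp add: has_bochner_integral_iff integrable_distr_eq integral_distr)
  then have "has_bochner_integral M (\<lambda>x. v * (X x / sqrt v)\<^sup>2) (v * 1)"
    by (rule has_bochner_integral_mult_right)
  then show ?thesis
    using v by (simp add: power_divide)
qed

definition quad :: "seg set \<Rightarrow> (seg \<Rightarrow> seg \<Rightarrow> real) \<Rightarrow> (seg \<Rightarrow> real) \<Rightarrow> (seg \<Rightarrow> real) \<Rightarrow> real" where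
  "quad S C x y = (\<Sum>s\<in>S. \<Sum>t\<in>S. x s * y t * C s t)"

text \<open>Each term is at most |C s t| times the mean of the squares of x s and x t. By symmetry
  the two halves have the same sum, which is governed by the absolute row sums.\<close>

lemma quad_le_row_sum:
  assumes "finite S" and sym: "\<And>s t. s \<in> S \<Longrightarrow> t \<in> S \<Longrightarrow> C s t = C t s"
    and row: "\<And>s. s \<in> S \<Longrightarrow> (\<Sum>t\<in>S. \<bar>C s t\<bar>) \<le> K"
  shows "quad S C x x \<le> K * (\<Sum>s\<in>S. (x s)\<^sup>2)"
proof -
  have "x s * x t * C s t \<le> (x s)\<^sup>2 * \<bar>C s t\<bar> / 2 + (x t)\<^sup>2 * \<bar>C s t\<bar> / 2" for s t
  proof -
    have "x s * x t * C s t \<le> \<bar>x s * x t\<bar> * \<bar>C s t\<bar>"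
      by (metis abs_ge_self abs_mult)
    also have "\<bar>x s * x t\<bar> \<le> ((x s)\<^sup>2 + (x t)\<^sup>2) / 2"
      using sum_squares_bound[of "\<bar>x s\<bar>" "\<bar>x t\<bar>"] by (simp add: abs_mult)
    finally show ?thesis
      by (simp add: mult_right_mono algebra_simps add_divide_distrib)
  qed
  then have "quad S C x x \<le> (\<Sum>s\<in>S. \<Sum>t\<in>S. (x s)\<^sup>2 * \<bar>C s t\<bar> / 2 + (x t)\<^sup>2 * \<bar>C s t\<bar> / 2)"
    unfolding quad_def by (intro sum_mono)
  also have "\<dots> = (\<Sum>s\<in>S. \<Sum>t\<in>S. (x s)\<^sup>2 * \<bar>C s t\<bar> / 2) + (\<Sum>s\<in>S. \<Sum>t\<in>S. (x t)\<^sup>2 * \<bar>C s t\<bar> / 2)"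
    by (simp add: sum.distrib)
  also have "(\<Sum>s\<in>S. \<Sum>t\<in>S. (x t)\<^sup>2 * \<bar>C s t\<bar> / 2) = (\<Sum>t\<in>S. \<Sum>s\<in>S. (x t)\<^sup>2 * \<bar>C s t\<bar> / 2)"
    by (rule sum.swap)
  also have "\<dots> = (\<Sum>s\<in>S. \<Sum>t\<in>S. (x s)\<^sup>2 * \<bar>C s t\<bar> / 2)"
    using sym by (intro sum.cong) auto
  finally have "quad S C x x \<le> (\<Sum>s\<in>S. (x s)\<^sup>2 * (\<Sum>t\<in>S. \<bar>C s t\<bar>))"
    by (simp add: sum_distrib_left sum_divide_distrib[symmetric])
  also have "\<dots> \<le> (\<Sum>s\<in>S. (x s)\<^sup>2 * K)"
    using row by (intro sum_mono mult_left_mono) auto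
  finally show ?thesis by (simp add: sum_distrib_left mult.commute)
qed

text \<open>The setting after conditioning on all routes: only the segment means \<theta> and the
  errors remain random.\<close>

locale gaussian_trips =
  fixes S :: "seg set" and \<sigma> :: "seg \<Rightarrow> seg \<Rightarrow> real" and G :: "(seg \<Rightarrow> real) measure"
    and Nn :: nat and \<mu> \<tau> :: real
  assumes finS[simp]: "finite S" and gauss: "gaussian_vec S \<sigma> G" and tau: "\<tau> > 0"
    and sym: "\<And>s t. s \<in> S \<Longrightarrow> t \<in> S \<Longrightarrow> \<sigma> s t = \<sigma> t s"
begin

abbreviation prior :: "(seg \<Rightarrow> real) measure" where
  "prior \<equiv> PiM S (\<lambda>_. density lborel (normal_density \<mu> \<tau>))"

abbreviation noise :: "(nat \<Rightarrow> seg \<Rightarrow> real) measure" where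
  "noise \<equiv> PiM {..<Nn} (\<lambda>_. G)"

definition Om :: "((seg \<Rightarrow> real) \<times> (nat \<Rightarrow> seg \<Rightarrow> real)) measure" where
  "Om = prior \<Otimes>\<^sub>M noise"

text \<open>A general centred linear functional: \<open>a\<close> weights the deviations of \<theta>
  from \<mu>, \<open>b n\<close> the errors of trip n.\<close>

definition lin :: "(seg \<Rightarrow> real) \<Rightarrow> (nat \<Rightarrow> seg \<Rightarrow> real) \<Rightarrow> (seg \<Rightarrow> real) \<times> (nat \<Rightarrow> seg \<Rightarrow> real) \<Rightarrow> real" where
  "lin a b w = (\<Sum>s\<in>S. a s * (fst w s - \<mu>)) + (\<Sum>n<Nn. \<Sum>s\<in>S. b n s * snd w n s)"

text \<open>Written down as a formula first; \<open>lin_mult\<close> identifies it as the covariance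
  of \<open>lin a b\<close> and \<open>lin a' b'\<close>.\<close>

definition cov where
  "cov a b a' b' = \<tau>\<^sup>2 * (\<Sum>s\<in>S. a s * a' s) + (\<Sum>n<Nn. quad S \<sigma> (b n) (b' n))"

sublocale G: prob_space G
  using gauss by (simp add: gaussian_vec_def)

lemma sets_G[measurable_cong]: "sets G = sets (PiM S (\<lambda>_. borel))"
  using gauss by (simp add: gaussian_vec_def)

sublocale Pr: prob_space "density lborel (normal_density \<mu> \<tau>)"
  using tau by (rule prob_space_normal_density)

sublocale PP: product_prob_space "\<lambda>_::seg. density lborel (normal_density \<mu> \<tau>)" S ..

sublocale GP: product_prob_space "\<lambda>_::nat. G" "{..<Nn}" ..

sublocale Om: prob_space Om
  unfolding Om_def by (intro prob_space_pair PP.prob_space_axioms GP.prob_space_axioms)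

lemma measurable_theta[measurable]: "s \<in> S \<Longrightarrow> (\<lambda>w. fst w s) \<in> borel_measurable Om"
  unfolding Om_def
  by (rule measurable_compose[OF measurable_fst])
     (rule measurable_compose[OF measurable_component_singleton], auto)

lemma measurable_error[measurable]: "n < Nn \<Longrightarrow> s \<in> S \<Longrightarrow> (\<lambda>w. snd w n s) \<in> borel_measurable Om"
  unfolding Om_def
  apply (rule measurable_compose[OF measurable_snd])
  apply (rule measurable_compose[where N=G])
   apply (rule measurable_component_singleton, simp)
  apply (subst measurable_cong_sets[OF sets_G refl])
  apply (rule measurable_component_singleton, simp)
  done

lemma measurable_lin[measurable]: "lin a b \<in> borel_measurable Om"
  unfolding lin_def
  by (intro borel_measurable_add borel_measurable_sum borel_measurable_times borel_measurable_diff
        borel_measurable_const measurable_theta measurable_error) auto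

text \<open>\<open>gaussian_vec\<close> prescribes the law of every single projection, and the
  projection along \<open>c\<close> is all that this value depends on. A projection of variance 0
  has no density and is treated separately.\<close>

lemma expectation_iexp_G: "(CLINT x|G. iexp (\<Sum>s\<in>S. c s * x s)) = exp (- quad S \<sigma> c c / 2)"
proof -
  define v where "v = quad S \<sigma> c c"
  define L where "L = (\<lambda>x. \<Sum>s\<in>S. c s * (x s :: real))"
  have v: "v \<ge> 0" "v > 0 \<Longrightarrow> distributed G lborel L (normal_density 0 (sqrt v))"
    "v = 0 \<Longrightarrow> AE x in G. L x = 0"
    using gauss unfolding gaussian_vec_def Let_def v_def quad_def L_def by blast+
  have [measurable]: "L \<in> borel_measurable G"
    unfolding L_def measurable_cong_sets[OF sets_G refl] by measurable
  show ?thesis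
  proof (cases "v = 0")
    case True
    then have "AE x in G. iexp (L x) = 1" using v(3) by auto
    then have "(CLINT x|G. iexp (L x)) = (CLINT x|G. 1)"
      by (intro integral_cong_AE) auto
    also have "\<dots> = 1" by (simp add: G.prob_space)
    finally show ?thesis using True by (simp add: v_def L_def)
  next
    case False
    with v have "v > 0" by simp
    from G.expectation_iexp_normal[OF v(2)[OF this], of 1] this show ?thesis
      by (simp add: L_def v_def)
  qed
qed

lemma expectation_iexp_prior: "(CLINT x|density lborel (normal_density \<mu> \<tau>). iexp (a * (x - \<mu>))) = exp (- (\<tau>\<^sup>2 * a\<^sup>2) / 2)"
proof -
  have "distributed (density lborel (normal_density \<mu> \<tau>)) lborel (\<lambda>x. x) (normal_density \<mu> \<tau>)"
    by (auto simp: distributed_def intro!: measure_eqI simp: emeasure_distr)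
  from Pr.expectation_iexp_normal[OF this tau, of a] show ?thesis by (simp add: mult.commute)
qed

text \<open>By independence the exponential factors into one term per segment and one per trip, and
  so does its integral over the product measure. The Gaussian exponents add up to the
  variance.\<close>

lemma expectation_iexp_lin: "(CLINT w|Om. iexp (lin a b w)) = exp (- cov a b a b / 2)"
proof -
  let ?f = "\<lambda>x. \<Prod>s\<in>S. iexp (a s * (x s - \<mu>))"
  let ?g = "\<lambda>e. \<Prod>n<Nn. iexp (\<Sum>s\<in>S. b n s * e n s)"
  interpret pair_prob_space prior noise ..
  have e: "iexp (lin a b w) = ?f (fst w) * ?g (snd w)" for w
    by (simp add: lin_def exp_add distrib_left exp_sum[symmetric] sum_distrib_left)
  have mf: "?f \<in> borel_measurable prior"
    by (intro borel_measurable_prod) (auto intro!: measurable_compose[OF measurable_component_singleton])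
  have mg: "?g \<in> borel_measurable noise"
  proof (intro borel_measurable_prod)
    fix n assume "n \<in> {..<Nn}"
    then show "(\<lambda>e. iexp (\<Sum>s\<in>S. b n s * e n s)) \<in> borel_measurable noise"
      by (intro measurable_compose[OF measurable_component_singleton[of n]])
         (auto simp: measurable_cong_sets[OF sets_G refl])
  qed
  have "(CLINT w|Om. iexp (lin a b w)) = (CLINT w|Om. ?f (fst w) * ?g (snd w))"
    by (simp only: e)
  also have "\<dots> = (CLINT x|prior. CLINT e|noise. ?f x * ?g e)"
  proof -
    have "integrable (prior \<Otimes>\<^sub>M noise) (\<lambda>w. ?f (fst w) * ?g (snd w))"
      using mf mg by (intro integrable_const_bound[where B=1])
        (auto simp: norm_mult prod_norm[symmetric])
    then show ?thesis
      unfolding Om_def by (subst integral_fst'[symmetric]) (auto simp: case_prod_beta)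
  qed
  also have "\<dots> = (CLINT x|prior. ?f x) * (CLINT e|noise. ?g e)"
    by simp
  also have "(CLINT x|prior. ?f x) = (\<Prod>s\<in>S. CLINT x|density lborel (normal_density \<mu> \<tau>). iexp (a s * (x - \<mu>)))"
    by (rule PP.product_integral_prod) (auto intro!: Pr.integrable_const_bound[where B=1])
  also have "(CLINT e|noise. ?g e) = (\<Prod>n<Nn. CLINT x|G. iexp (\<Sum>s\<in>S. b n s * x s))"
    by (rule GP.product_integral_prod) (auto intro!: G.integrable_const_bound[where B=1] simp: measurable_cong_sets[OF sets_G refl])
  finally have "(CLINT w|Om. iexp (lin a b w)) =
     (\<Prod>s\<in>S. complex_of_real (exp (- (\<tau>\<^sup>2 * (a s)\<^sup>2) / 2))) * (\<Prod>n<Nn. complex_of_real (exp (- quad S \<sigma> (b n) (b n) / 2)))"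
    by (simp only: expectation_iexp_G expectation_iexp_prior)
  also have "\<dots> = exp (- cov a b a b / 2)"
    by (simp add: exp_sum[symmetric] exp_add[symmetric] cov_def power2_eq_square sum_negf sum_distrib_left
        sum_divide_distrib[symmetric] add_divide_distrib diff_divide_distrib flip: of_real_prod of_real_mult)
  finally show ?thesis .
qed


section \<open>Second moments and orthogonality of linear functionals\<close>

lemma quad_commute: "quad S \<sigma> x y = quad S \<sigma> y x"
proof -
  have "quad S \<sigma> x y = (\<Sum>t\<in>S. \<Sum>s\<in>S. x s * y t * \<sigma> s t)"
    unfolding quad_def by (rule sum.swap)
  also have "\<dots> = quad S \<sigma> y x"
    unfolding quad_def using sym by (intro sum.cong) (auto simp: mult.commute)
  finally show ?thesis .
qed

lemma quad_add:
  "quad S \<sigma> (\<lambda>s. x s + u * y s) (\<lambda>s. x s + u * y s) =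
    quad S \<sigma> x x + 2 * u * quad S \<sigma> x y + u\<^sup>2 * quad S \<sigma> y y"
proof -
  have "quad S \<sigma> (\<lambda>s. x s + u * y s) (\<lambda>s. x s + u * y s) =
    quad S \<sigma> x x + u * quad S \<sigma> x y + u * quad S \<sigma> y x + u\<^sup>2 * quad S \<sigma> y y"
    unfolding quad_def by (simp add: algebra_simps sum.distrib sum_distrib_left power2_eq_square)
  then show ?thesis by (simp add: quad_commute[of y x])
qed

lemma cov_add:
  "cov (\<lambda>s. a s + u * a' s) (\<lambda>n s. b n s + u * b' n s) (\<lambda>s. a s + u * a' s) (\<lambda>n s. b n s + u * b' n s)
    = cov a b a b + 2 * u * cov a b a' b' + u\<^sup>2 * cov a' b' a' b'"
  unfolding cov_def quad_add
  by (simp add: algebra_simps sum.distrib sum_distrib_left power2_eq_square)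

lemma lin_add:
  "lin (\<lambda>s. a s + u * a' s) (\<lambda>n s. b n s + u * b' n s) w = lin a b w + u * lin a' b' w"
  unfolding lin_def by (simp add: algebra_simps sum.distrib sum_distrib_left sum_subtractf)

lemma cov_scale: "cov (\<lambda>s. u * a s) (\<lambda>n s. u * b n s) (\<lambda>s. u * a s) (\<lambda>n s. u * b n s) = u\<^sup>2 * cov a b a b"
  using cov_add[of "\<lambda>_. 0" u a "\<lambda>_ _. 0" b] by (simp add: cov_def quad_def)

lemma lin_scale: "lin (\<lambda>s. u * a s) (\<lambda>n s. u * b n s) w = u * lin a b w"
  using lin_add[of "\<lambda>_. 0" u a "\<lambda>_ _. 0" b] by (simp add: lin_def)

lemma cov_nonneg: "cov a b a b \<ge> 0"
proof -
  have "quad S \<sigma> x x \<ge> 0" for x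
    using gauss unfolding gaussian_vec_def Let_def quad_def by blast
  then show ?thesis
    unfolding cov_def by (intro add_nonneg_nonneg mult_nonneg_nonneg[OF zero_le_power2] sum_nonneg) auto
qed

lemma lin_square: "has_bochner_integral Om (\<lambda>w. (lin a b w)\<^sup>2) (cov a b a b)"
proof (rule Om.has_bochner_integral_square_of_gaussian_char)
  fix t
  show "(CLINT w|Om. iexp (t * lin a b w)) = exp (- (t\<^sup>2 * cov a b a b) / 2)"
    using expectation_iexp_lin[of "\<lambda>s. t * a s" "\<lambda>n s. t * b n s"]
    by (simp only: lin_scale cov_scale)
qed (auto simp: cov_nonneg)

text \<open>Polarisation of \<open>lin_square\<close>.\<close>

lemma lin_mult: "has_bochner_integral Om (\<lambda>w. lin a b w * lin a' b' w) (cov a b a' b')"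
proof -
  have "has_bochner_integral Om
     (\<lambda>w. ((lin a b w + 1 * lin a' b' w)\<^sup>2 - (lin a b w)\<^sup>2 - (lin a' b' w)\<^sup>2) / 2)
     ((cov a b a b + 2 * 1 * cov a b a' b' + 1\<^sup>2 * cov a' b' a' b' - cov a b a b - cov a' b' a' b') / 2)"
    unfolding cov_add[symmetric] lin_add[symmetric]
    by (intro has_bochner_integral_divide has_bochner_integral_diff lin_square)
  then show ?thesis
    by (simp add: power2_sum)
qed

lemma integrable_lin: "integrable Om (lin a b)"
proof (rule Bochner_Integration.integrable_bound)
  show "integrable Om (\<lambda>w. 1 + (lin a b w)\<^sup>2)"
    using lin_square[of a b] by (auto simp: has_bochner_integral_iff)
  have "\<bar>x\<bar> \<le> 1 + x\<^sup>2" for x :: real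
    using zero_le_power2[of "\<bar>x\<bar> - 1"] zero_le_power2[of x]
    unfolding power2_diff power2_abs by (simp del: zero_le_power2)
  then show "AE w in Om. norm (lin a b w) \<le> norm (1 + (lin a b w)\<^sup>2)"
    by (auto intro!: AE_I2)
qed auto

text \<open>In substance the derivative at u = 0 of the characteristic function of
  \<open>lin a' b' + u * lin a b\<close>. Without covariance this function is even in u. Symmetric
  differences, which produce \<open>sin (u * lin a b)\<close>, therefore vanish for every u, and sin
  (u x) / u tends to x with |x| as a dominating bound.\<close>

lemma expectation_lin_iexp_eq_0:
  assumes "cov a b a' b' = 0"
  shows "(CLINT w|Om. complex_of_real (lin a b w) * iexp (lin a' b' w)) = 0"
proof -
  have "cov a' b' a b = 0"
    using assms by (simp add: cov_def quad_commute mult.commute)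
  then have E: "(CLINT w|Om. iexp (lin a' b' w + u * lin a b w)) = exp (- (cov a' b' a' b' + u\<^sup>2 * cov a b a b) / 2)" for u
    using expectation_iexp_lin[of "\<lambda>s. a' s + u * a s" "\<lambda>n s. b' n s + u * b n s"]
    by (simp only: lin_add cov_add) simp
  have int: "integrable Om (\<lambda>w. iexp (lin a' b' w + u * lin a b w))" for u
    by (rule Om.integrable_iexp) auto
  have Z: "(CLINT w|Om. complex_of_real (sin (u * lin a b w)) * iexp (lin a' b' w)) = 0" for u
  proof -
    have "complex_of_real (sin (u * x)) * iexp y = (iexp (y + u * x) - iexp (y + (- u) * x)) / (2 * \<i>)" for x y
      by (simp add: sin_exp_eq sin_of_real[symmetric] exp_add exp_minus algebra_simps exp_diff)
         (simp add: divide_simps)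
    then have "(CLINT w|Om. complex_of_real (sin (u * lin a b w)) * iexp (lin a' b' w))
      = (CLINT w|Om. (iexp (lin a' b' w + u * lin a b w) - iexp (lin a' b' w + (- u) * lin a b w)) / (2 * \<i>))"
      by (simp only:)
    also have "\<dots> = ((CLINT w|Om. iexp (lin a' b' w + u * lin a b w)) - (CLINT w|Om. iexp (lin a' b' w + (- u) * lin a b w))) / (2 * \<i>)"
      using int[of u] int[of "-u"] by (simp only: integral_divide_zero Bochner_Integration.integral_diff)
    \<comment> \<open>By \<open>E\<close> the two expectations depend on u only through its
      square.\<close>
    also have "\<dots> = 0" by (simp only: E) simp
    finally show ?thesis .
  qed
  \<comment> \<open>The difference quotients for u = 1 / (n + 1).\<close>
  let ?s = "\<lambda>n w. complex_of_real (real (Suc n) * sin (1 / real (Suc n) * lin a b w)) * iexp (lin a' b' w)"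
  have "(\<lambda>n. CLINT w|Om. ?s n w) \<longlonglongrightarrow> (CLINT w|Om. complex_of_real (lin a b w) * iexp (lin a' b' w))"
  proof (rule integral_dominated_convergence[where w="\<lambda>w. \<bar>lin a b w\<bar>"])
    show "integrable Om (\<lambda>w. \<bar>lin a b w\<bar>)" using integrable_lin by auto
    show "AE w in Om. (\<lambda>n. ?s n w) \<longlonglongrightarrow> complex_of_real (lin a b w) * iexp (lin a' b' w)"
    proof (intro AE_I2 tendsto_mult tendsto_of_real tendsto_const)
      fix w
      have "((\<lambda>x. sin (x * lin a b w)) has_real_derivative lin a b w) (at 0)"
        by (auto intro!: derivative_eq_intros)
      then have "((\<lambda>h. sin (h * lin a b w) / h) \<longlongrightarrow> lin a b w) (at 0)"
        by (simp add: DERIV_def)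
      moreover have "filterlim (\<lambda>n. 1 / real (Suc n)) (at 0) sequentially"
        using LIMSEQ_inverse_real_of_nat by (auto simp: filterlim_at inverse_eq_divide)
      ultimately have "((\<lambda>n. sin (1 / real (Suc n) * lin a b w) / (1 / real (Suc n))) \<longlonglongrightarrow> lin a b w)"
        by (rule filterlim_compose)
      then show "(\<lambda>n. real (Suc n) * sin (1 / real (Suc n) * lin a b w)) \<longlonglongrightarrow> lin a b w"
        by (simp add: mult.commute)
    qed
    fix n
    have "\<bar>real (Suc n) * sin (1 / real (Suc n) * x)\<bar> \<le> \<bar>x\<bar>" for x
      using abs_sin_x_le_abs_x[of "1 / real (Suc n) * x"]
      by (simp add: abs_mult divide_simps mult.commute)
    then show "AE w in Om. norm (?s n w) \<le> \<bar>lin a b w\<bar>"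
      by (intro AE_I2) (simp only: norm_mult norm_of_real norm_exp_i_times mult_1_right)
  qed auto
  moreover have "(CLINT w|Om. ?s n w) = 0" for n
    using Z[of "1 / real (Suc n)"] by (simp only: of_real_mult mult.assoc integral_mult_right_zero mult_zero_right)
  ultimately show ?thesis
    by (simp add: LIMSEQ_const_iff del: of_real_mult of_nat_Suc)
qed

end

section \<open>Risk bounds for given routes\<close>

lemma hist_count_eq_sum: "real (hist_count Nn yh s) = (\<Sum>n<Nn. if s \<in> yh n then 1 else 0)"
proof -
  have "(\<Sum>n<Nn. if s \<in> yh n then 1 else 0 :: real) = (\<Sum>n\<in>{n\<in>{..<Nn}. s \<in> yh n}. 1)"
    by (rule sum.inter_filter[symmetric]) simp
  also have "{n\<in>{..<Nn}. s \<in> yh n} = {n. n < Nn \<and> s \<in> yh n}" by auto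
  finally show ?thesis by (simp add: hist_count_def)
qed

context gaussian_trips
begin

text \<open>The travel-time component of \<open>observe\<close> with the routes frozen; unobserved
  entries are the constant 0 and carry no information.\<close>

definition obs :: "(nat \<Rightarrow> seg set) \<Rightarrow> (seg \<Rightarrow> real) \<times> (nat \<Rightarrow> seg \<Rightarrow> real) \<Rightarrow> nat \<Rightarrow> seg \<Rightarrow> real" where
  "obs yh w = (\<lambda>n\<in>{..<Nn}. \<lambda>s\<in>S. if s \<in> yh n then fst w s + snd w n s else 0)"

lemma sum_theta_eq_lin:
  assumes "y \<subseteq> S"
  shows "(\<Sum>s\<in>y. fst w s) = \<mu> * real (card y) + lin (\<lambda>s. if s \<in> y then 1 else 0) (\<lambda>_ _. 0) w"
proof -
  have "(\<Sum>s\<in>S. (if s \<in> y then 1 else 0) * (fst w s - \<mu>)) = (\<Sum>s\<in>S. if s \<in> y then fst w s - \<mu> else 0)"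
    by (intro sum.cong) auto
  also have "\<dots> = (\<Sum>s\<in>y. fst w s - \<mu>)"
    using assms by (subst sum.inter_restrict[symmetric]) (auto simp: Int_absorb1)
  finally show ?thesis
    by (simp add: lin_def sum_subtractf)
qed

text \<open>\<open>orth\<close> makes \<open>V = lin a b\<close> uncorrelated with every observed
  travel time; \<open>orth0\<close> says that the covariance matrix maps \<open>b n\<close> to a
  vector supported on the route, which determines \<open>quad S \<sigma> (b n) z\<close> for all
  \<open>z\<close>. Orthogonality of \<open>V\<close> to the estimate turns E[V f], for the
  estimation error f, into minus the covariance of \<open>V\<close> with the target. The bound is
  then E[(f + \<tau>^2 V)^2] \<ge> 0, expanded.\<close>

lemma bayes_risk_ge_of_uncorrelated:
  assumes y: "y \<subseteq> S"
    and k[measurable]: "k \<in> borel_measurable (PiM {..<Nn} (\<lambda>_. PiM S (\<lambda>_. borel)))"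
    and orth: "\<And>n s. n < Nn \<Longrightarrow> s \<in> S \<Longrightarrow> s \<in> yh n \<Longrightarrow> \<tau>\<^sup>2 * a s + (\<Sum>t\<in>S. \<sigma> s t * b n t) = 0"
    and orth0: "\<And>n s. n < Nn \<Longrightarrow> s \<in> S \<Longrightarrow> s \<notin> yh n \<Longrightarrow> (\<Sum>t\<in>S. \<sigma> s t * b n t) = 0"
  shows "ennreal (2 * \<tau>\<^sup>2 * (\<tau>\<^sup>2 * (\<Sum>s\<in>y. a s)) - \<tau>^4 * cov a b a b)
    \<le> (\<integral>\<^sup>+w. ennreal ((k (obs yh w) - (\<Sum>s\<in>y. fst w s))\<^sup>2) \<partial>Om)"
proof (cases "(\<integral>\<^sup>+w. ennreal ((k (obs yh w) - (\<Sum>s\<in>y. fst w s))\<^sup>2) \<partial>Om) = \<infinity>")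
  \<comment> \<open>For infinite risk there is nothing to prove. Finite risk makes the error square
    integrable, hence its product with \<open>V\<close> integrable.\<close>
  case False
  define \<Theta> where "\<Theta> = lin (\<lambda>s. if s \<in> y then 1 else 0) (\<lambda>_ _. 0)"
  define V where "V = lin a b"
  \<comment> \<open>The doubly indexed observations are flattened to one finite index set, as
    \<open>fourier_vanish\<close> requires; \<open>kk\<close> is the estimator in these
    coordinates.\<close>
  define I where "I = {..<Nn} \<times> S"
  define X where "X i w = (if snd i \<in> yh (fst i) then fst w (snd i) + snd w (fst i) (snd i) else 0)"
    for i :: "nat \<times> seg" and w :: "(seg \<Rightarrow> real) \<times> (nat \<Rightarrow> seg \<Rightarrow> real)"
  define kk where "kk x = k (\<lambda>n\<in>{..<Nn}. \<lambda>s\<in>S. x (n, s))" for x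
  have X[measurable]: "X i \<in> borel_measurable Om" if "i \<in> I" for i
    using that unfolding X_def I_def
    by (cases "snd i \<in> yh (fst i)")
       (auto intro!: borel_measurable_add measurable_theta measurable_error)
  have kk[measurable]: "kk \<in> borel_measurable (PiM I (\<lambda>_. borel))"
    unfolding kk_def I_def
    by (rule measurable_compose[OF _ k]) (auto intro!: measurable_restrict measurable_component_singleton)
  have kobs: "k (obs yh w) = kk (\<lambda>i\<in>I. X i w)" for w
    unfolding kk_def obs_def
    by (rule arg_cong[where f=k]) (auto simp: I_def X_def fun_eq_iff restrict_def)
  have [measurable]: "(\<lambda>w. kk (\<lambda>i\<in>I. X i w)) \<in> borel_measurable Om"
    by (rule measurable_compose[OF _ kk], rule measurable_restrict) (use X in auto)
  have [measurable]: "V \<in> borel_measurable Om" "\<Theta> \<in> borel_measurable Om"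
    unfolding V_def \<Theta>_def by auto
  define f where "f w = kk (\<lambda>i\<in>I. X i w) - \<mu> * real (card y) - \<Theta> w" for w
  have f_eq: "k (obs yh w) - (\<Sum>s\<in>y. fst w s) = f w" for w
    unfolding f_def kobs \<Theta>_def sum_theta_eq_lin[OF y] by simp
  have [measurable]: "f \<in> borel_measurable Om" unfolding f_def by measurable
  have "integrable Om (\<lambda>w. (f w)\<^sup>2)"
    using False by (intro integrableI_nonneg) (auto simp: f_eq top.not_eq_extremum)
  note f2 = this
  have iV: "integrable Om V" unfolding V_def by (rule integrable_lin)
  have V2: "has_bochner_integral Om (\<lambda>w. (V w)\<^sup>2) (cov a b a b)"
    unfolding V_def by (rule lin_square)
  have iVf: "integrable Om (\<lambda>w. V w * f w)"
  proof (rule Bochner_Integration.integrable_bound)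
    show "integrable Om (\<lambda>w. (V w)\<^sup>2 + (f w)\<^sup>2)"
      using V2 f2 by (auto simp: has_bochner_integral_iff)
    have "\<bar>u * v\<bar> \<le> u\<^sup>2 + v\<^sup>2" for u v :: real
    proof -
      have "0 \<le> \<bar>u\<bar> * \<bar>v\<bar>" by simp
      then show ?thesis
        using sum_squares_bound[of "\<bar>u\<bar>" "\<bar>v\<bar>"] unfolding abs_mult power2_abs by linarith
    qed
    then show "AE w in Om. norm (V w * f w) \<le> norm ((V w)\<^sup>2 + (f w)\<^sup>2)"
      by (auto intro!: AE_I2)
  qed auto
  have sig: "quad S \<sigma> (b n) z = - \<tau>\<^sup>2 * (\<Sum>s\<in>S. (if s \<in> yh n then a s else 0) * z s)" if "n < Nn" for n z
  proof -
    have "quad S \<sigma> (b n) z = (\<Sum>s\<in>S. z s * (\<Sum>t\<in>S. \<sigma> s t * b n t))"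
      by (subst quad_commute) (simp add: quad_def sum_distrib_left mult_ac)
    also have "\<dots> = (\<Sum>s\<in>S. - \<tau>\<^sup>2 * ((if s \<in> yh n then a s else 0) * z s))"
    proof (intro sum.cong refl)
      fix s assume "s \<in> S"
      show "z s * (\<Sum>t\<in>S. \<sigma> s t * b n t) = - \<tau>\<^sup>2 * ((if s \<in> yh n then a s else 0) * z s)"
      proof (cases "s \<in> yh n")
        case True
        then have "(\<Sum>t\<in>S. \<sigma> s t * b n t) = - (\<tau>\<^sup>2 * a s)"
          using orth[OF that \<open>s \<in> S\<close>] by linarith
        with True show ?thesis by simp
      next
        case False
        then show ?thesis using orth0[OF that \<open>s \<in> S\<close>] by simp
      qed
    qed
    finally show ?thesis by (simp only: sum_distrib_left)
  qed
  have zero: "(CLINT w|Om. complex_of_real (V w) * iexp (\<Sum>i\<in>I. c i * X i w)) = 0" for c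
  proof -
    \<comment> \<open>A linear combination of observations is a constant plus
      \<open>lin a' b'\<close>, where \<open>b' n\<close> is supported on route n and
      \<open>a'\<close> collects the weights that each segment receives over all trips.\<close>
    define b' where "b' n s = (if s \<in> yh n then c (n, s) else 0)" for n s
    define a' where "a' s = (\<Sum>n<Nn. b' n s)" for s
    have "(\<Sum>i\<in>I. c i * X i w) = \<mu> * (\<Sum>s\<in>S. a' s) + lin a' b' w" for w
    proof -
      have "(\<Sum>i\<in>I. c i * X i w) = (\<Sum>n<Nn. \<Sum>s\<in>S. c (n, s) * X (n, s) w)"
        unfolding I_def by (simp add: sum.cartesian_product)
      also have "\<dots> = (\<Sum>n<Nn. \<Sum>s\<in>S. b' n s * \<mu> + b' n s * (fst w s - \<mu>) + b' n s * snd w n s)"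
        by (intro sum.cong) (auto simp: X_def b'_def algebra_simps)
      also have "\<dots> = (\<Sum>n<Nn. \<Sum>s\<in>S. b' n s * \<mu>) + (\<Sum>n<Nn. \<Sum>s\<in>S. b' n s * (fst w s - \<mu>))
          + (\<Sum>n<Nn. \<Sum>s\<in>S. b' n s * snd w n s)"
        by (simp add: sum.distrib)
      also have "(\<Sum>n<Nn. \<Sum>s\<in>S. b' n s * (fst w s - \<mu>)) = (\<Sum>s\<in>S. a' s * (fst w s - \<mu>))"
        unfolding a'_def by (subst sum.swap) (simp add: sum_distrib_right)
      also have "(\<Sum>n<Nn. \<Sum>s\<in>S. b' n s * \<mu>) = \<mu> * (\<Sum>s\<in>S. a' s)"
        unfolding a'_def by (subst sum.swap) (simp add: sum_distrib_right sum_distrib_left mult.commute)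
      finally show ?thesis by (simp add: lin_def)
    qed
    then have "(CLINT w|Om. complex_of_real (V w) * iexp (\<Sum>i\<in>I. c i * X i w))
       = (CLINT w|Om. iexp (\<mu> * (\<Sum>s\<in>S. a' s)) * (complex_of_real (V w) * iexp (lin a' b' w)))"
      by (simp add: exp_add distrib_left mult_ac del: of_real_sum)
    also have "\<dots> = iexp (\<mu> * (\<Sum>s\<in>S. a' s)) * (CLINT w|Om. complex_of_real (V w) * iexp (lin a' b' w))"
      by simp
    also have "(CLINT w|Om. complex_of_real (V w) * iexp (lin a' b' w)) = 0"
      unfolding V_def
    proof (rule expectation_lin_iexp_eq_0)
      \<comment> \<open>The error part of the covariance is the negative of the prior part.\<close>
      have "(\<Sum>n<Nn. quad S \<sigma> (b n) (b' n)) = (\<Sum>n<Nn. - \<tau>\<^sup>2 * (\<Sum>s\<in>S. a s * b' n s))"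
      proof (intro sum.cong refl)
        fix n assume "n \<in> {..<Nn}"
        moreover have "(if s \<in> yh n then a s else 0) * b' n s = a s * b' n s" for s
          by (simp add: b'_def)
        ultimately show "quad S \<sigma> (b n) (b' n) = - \<tau>\<^sup>2 * (\<Sum>s\<in>S. a s * b' n s)"
          by (simp only: sig lessThan_iff)
      qed
      also have "\<dots> = - \<tau>\<^sup>2 * (\<Sum>s\<in>S. a s * a' s)"
        unfolding a'_def sum_distrib_left by (rule sum.swap)
      finally show "cov a b a' b' = 0"
        by (simp add: cov_def)
    qed
    finally show ?thesis by simp
  qed
  have EV: "(\<integral>w. V w \<partial>Om) = 0"
    using zero[of "\<lambda>_. 0"] by simp
  have VT: "has_bochner_integral Om (\<lambda>w. V w * \<Theta> w) (\<tau>\<^sup>2 * (\<Sum>s\<in>y. a s))"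
  proof -
    have "cov a b (\<lambda>s. if s \<in> y then 1 else 0) (\<lambda>_ _. 0) = \<tau>\<^sup>2 * (\<Sum>s\<in>S. if s \<in> y then a s else 0)"
      unfolding cov_def quad_def by (auto intro!: sum.cong)
    also have "(\<Sum>s\<in>S. if s \<in> y then a s else 0) = (\<Sum>s\<in>y. a s)"
      using y by (subst sum.inter_restrict[symmetric]) (auto simp: Int_absorb1)
    finally show ?thesis
      using lin_mult[of a b "\<lambda>s. if s \<in> y then 1 else 0" "\<lambda>_ _. 0"] by (simp add: V_def \<Theta>_def)
  qed
  \<comment> \<open>The estimate is the error plus a constant plus the centred target. This shows
    integrability of its product with \<open>V\<close>, and later gives the expectation of
    \<open>V * f\<close>.\<close>
  have Vk: "V w * kk (\<lambda>i\<in>I. X i w) = V w * f w + \<mu> * real (card y) * V w + V w * \<Theta> w" for w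
    unfolding f_def by (simp add: algebra_simps)
  have "(\<integral>w. V w * kk (\<lambda>i\<in>I. X i w) \<partial>Om) = 0"
  proof (rule fourier_vanish[OF _ X iV zero kk])
    show "integrable Om (\<lambda>w. V w * kk (\<lambda>i\<in>I. X i w))"
      unfolding Vk using iVf iV VT by (auto simp: has_bochner_integral_iff)
  qed (auto simp: I_def)
  then have EVf: "(\<integral>w. V w * f w \<partial>Om) = - (\<tau>\<^sup>2 * (\<Sum>s\<in>y. a s))"
    unfolding Vk using iVf iV VT EV by (simp add: has_bochner_integral_iff)
  \<comment> \<open>E[V f] is negative for positive weights, so \<open>V\<close> is added to the
    error, not subtracted.\<close>
  have "0 \<le> (\<integral>w. (f w + \<tau>\<^sup>2 * V w)\<^sup>2 \<partial>Om)"
    by simp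
  also have "(\<integral>w. (f w + \<tau>\<^sup>2 * V w)\<^sup>2 \<partial>Om)
      = (\<integral>w. (f w)\<^sup>2 + 2 * \<tau>\<^sup>2 * (V w * f w) + \<tau>^4 * (V w)\<^sup>2 \<partial>Om)"
    by (intro Bochner_Integration.integral_cong) (auto simp: power2_eq_square power4_eq_xxxx algebra_simps)
  also have "\<dots> = (\<integral>w. (f w)\<^sup>2 \<partial>Om) + 2 * \<tau>\<^sup>2 * (- (\<tau>\<^sup>2 * (\<Sum>s\<in>y. a s))) + \<tau>^4 * cov a b a b"
    using f2 iVf V2 EVf by (simp add: has_bochner_integral_iff)
  finally have "2 * \<tau>\<^sup>2 * (\<tau>\<^sup>2 * (\<Sum>s\<in>y. a s)) - \<tau>^4 * cov a b a b \<le> (\<integral>w. (f w)\<^sup>2 \<partial>Om)"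
    by simp
  then show ?thesis
    using f2 unfolding f_eq by (subst nn_integral_eq_integral) (auto intro: ennreal_leI)
qed simp

text \<open>With \<open>b n = - \<tau>\<^sup>2 \<Psi> x\<close>, x being \<open>a\<close> cut down
  to route n, \<open>V\<close> is uncorrelated with the data and its variance is at most the sum of
  \<open>(a s)\<^sup>2 * d s\<close>. The preceding bound then becomes \<tau>^4 times a sum of terms
  2 a - a^2 d, each largest at a = 1 / d.\<close>

lemma bayes_risk_ge:
  assumes y: "y \<subseteq> S"
    and k: "k \<in> borel_measurable (PiM {..<Nn} (\<lambda>_. PiM S (\<lambda>_. borel)))"
    and inv1: "\<And>s u. s \<in> S \<Longrightarrow> u \<in> S \<Longrightarrow> (\<Sum>t\<in>S. \<sigma> s t * \<psi> t u) = (if s = u then 1 else 0)"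
    and inv2: "\<And>s u. s \<in> S \<Longrightarrow> u \<in> S \<Longrightarrow> (\<Sum>t\<in>S. \<psi> s t * \<sigma> t u) = (if s = u then 1 else 0)"
    and row: "\<And>s. s \<in> S \<Longrightarrow> (\<Sum>t\<in>S. \<bar>\<psi> s t\<bar>) \<le> C" and C: "C \<ge> 0"
  shows "ennreal (\<Sum>s\<in>y. 1 / (1 / \<tau>\<^sup>2 + C * real (hist_count Nn yh s)))
    \<le> (\<integral>\<^sup>+w. ennreal ((k (obs yh w) - (\<Sum>s\<in>y. fst w s))\<^sup>2) \<partial>Om)"
proof -
  \<comment> \<open>The coefficient of \<open>(a s)\<^sup>2\<close> in the variance bound: \<tau>^2
    from the prior, and \<tau>^4 C from each trip through the segment.\<close>
  define d where "d s = \<tau>\<^sup>2 + \<tau>^4 * C * real (hist_count Nn yh s)" for s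
  define a where "a s = (if s \<in> y then 1 / d s else 0)" for s
  define x where "x n s = (if s \<in> yh n then a s else 0)" for n s
  define b where "b n s = - \<tau>\<^sup>2 * (\<Sum>t\<in>S. \<psi> s t * x n t)" for n s
  have d: "d s > 0" for s
    unfolding d_def using tau C by (intro add_pos_nonneg) auto
  \<comment> \<open>The row sum bound needs a symmetric matrix. The inverse inherits symmetry from
    \<sigma>: inserting \<sigma> times the transpose of \<psi>, which is the identity, moves one
    factor across.\<close>
  have psi_sym: "\<psi> s u = \<psi> u s" if su: "s \<in> S" "u \<in> S" for s u
  proof -
    have "\<psi> s u = (\<Sum>v\<in>S. \<psi> s v * (if v = u then 1 else 0))"
      using su by (simp add: if_distrib cong: if_cong)
    also have "\<dots> = (\<Sum>v\<in>S. \<psi> s v * (\<Sum>t\<in>S. \<sigma> v t * \<psi> u t))"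
    proof (intro sum.cong refl)
      fix v assume v: "v \<in> S"
      have "(\<Sum>t\<in>S. \<sigma> v t * \<psi> u t) = (\<Sum>t\<in>S. \<psi> u t * \<sigma> t v)"
        using v sym by (intro sum.cong) (auto simp: mult.commute)
      then show "\<psi> s v * (if v = u then 1 else 0) = \<psi> s v * (\<Sum>t\<in>S. \<sigma> v t * \<psi> u t)"
        using inv2[OF su(2) v] by auto
    qed
    also have "\<dots> = (\<Sum>t\<in>S. (\<Sum>v\<in>S. \<psi> s v * \<sigma> v t) * \<psi> u t)"
      unfolding sum_distrib_left sum_distrib_right by (subst sum.swap) (simp add: mult_ac)
    also have "\<dots> = (\<Sum>t\<in>S. (if s = t then 1 else 0) * \<psi> u t)"
      using su inv2 by (intro sum.cong) auto
    also have "\<dots> = \<psi> u s"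
      using su by (simp add: if_distrib[of "\<lambda>z. z * _"] cong: if_cong)
    finally show ?thesis .
  qed
  have sb: "(\<Sum>t\<in>S. \<sigma> s t * b n t) = - \<tau>\<^sup>2 * x n s" if s: "s \<in> S" for s n
  proof -
    have "(\<Sum>t\<in>S. \<sigma> s t * b n t) = - \<tau>\<^sup>2 * (\<Sum>t\<in>S. \<Sum>u\<in>S. \<sigma> s t * \<psi> t u * x n u)"
      unfolding b_def by (simp add: sum_distrib_left mult_ac)
    also have "(\<Sum>t\<in>S. \<Sum>u\<in>S. \<sigma> s t * \<psi> t u * x n u) = (\<Sum>u\<in>S. (\<Sum>t\<in>S. \<sigma> s t * \<psi> t u) * x n u)"
      by (subst sum.swap) (simp add: sum_distrib_right)
    also have "\<dots> = (\<Sum>u\<in>S. (if s = u then 1 else 0) * x n u)"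
      using s inv1 by (intro sum.cong) auto
    also have "\<dots> = x n s"
      using s by (simp add: if_distrib[of "\<lambda>z. z * _"] cong: if_cong)
    finally show ?thesis .
  qed
  have qb: "quad S \<sigma> (b n) (b n) \<le> \<tau>^4 * (C * (\<Sum>s\<in>S. (x n s)\<^sup>2))" for n
  proof -
    have "quad S \<sigma> (b n) (b n) = (\<Sum>s\<in>S. b n s * (\<Sum>t\<in>S. \<sigma> s t * b n t))"
      unfolding quad_def by (simp add: sum_distrib_left mult_ac)
    also have "\<dots> = (\<Sum>s\<in>S. b n s * (- \<tau>\<^sup>2 * x n s))"
      using sb by (intro sum.cong) auto
    \<comment> \<open>Since \<sigma> maps \<open>b n\<close> to a multiple of \<open>x n\<close>,
      the form of \<sigma> at \<open>b n\<close> is a form of \<psi> at \<open>x n\<close>, to which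
      the row sums of \<psi> apply.\<close>
    also have "\<dots> = \<tau>^4 * quad S \<psi> (x n) (x n)"
      unfolding b_def quad_def by (simp add: sum_distrib_left power2_eq_square power4_eq_xxxx sum_negf mult_ac)
    also have "\<dots> \<le> \<tau>^4 * (C * (\<Sum>s\<in>S. (x n s)\<^sup>2))"
      by (intro mult_left_mono quad_le_row_sum psi_sym row) auto
    finally show ?thesis .
  qed
  have "cov a b a b \<le> \<tau>\<^sup>2 * (\<Sum>s\<in>S. a s * a s) + (\<Sum>n<Nn. \<tau>^4 * (C * (\<Sum>s\<in>S. (x n s)\<^sup>2)))"
    unfolding cov_def by (intro add_left_mono sum_mono qb)
  also have "(\<Sum>n<Nn. \<tau>^4 * (C * (\<Sum>s\<in>S. (x n s)\<^sup>2))) = (\<Sum>s\<in>S. \<Sum>n<Nn. \<tau>^4 * C * (x n s)\<^sup>2)"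
    by (subst sum.swap) (simp add: sum_distrib_left mult_ac)
  also have "\<dots> = (\<Sum>s\<in>S. \<tau>^4 * C * (a s)\<^sup>2 * real (hist_count Nn yh s))"
    unfolding hist_count_eq_sum sum_distrib_left
    by (intro sum.cong) (auto simp: x_def)
  also have "\<tau>\<^sup>2 * (\<Sum>s\<in>S. a s * a s) + \<dots> = (\<Sum>s\<in>S. (a s)\<^sup>2 * d s)"
    unfolding d_def by (simp add: sum_distrib_left sum.distrib algebra_simps power2_eq_square)
  also have "\<dots> = (\<Sum>s\<in>S. if s \<in> y then 1 / d s else 0)"
    using d by (intro sum.cong) (auto simp: a_def power2_eq_square less_imp_neq[symmetric])
  also have "\<dots> = (\<Sum>s\<in>y. 1 / d s)"
    using y by (subst sum.inter_restrict[symmetric]) (auto simp: Int_absorb1)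
  finally have cv: "cov a b a b \<le> (\<Sum>s\<in>y. 1 / d s)" .
  have "(\<Sum>s\<in>y. 1 / (1 / \<tau>\<^sup>2 + C * real (hist_count Nn yh s))) = \<tau>^4 * (\<Sum>s\<in>y. 1 / d s)"
    unfolding sum_distrib_left
  proof (intro sum.cong refl)
    fix s
    have "d s = \<tau>^4 * (1 / \<tau>\<^sup>2 + C * real (hist_count Nn yh s))"
      unfolding d_def using tau by (simp add: power2_eq_square power4_eq_xxxx field_simps)
    then show "1 / (1 / \<tau>\<^sup>2 + C * real (hist_count Nn yh s)) = \<tau>^4 * (1 / d s)"
      using tau by simp
  qed
  also have "\<dots> \<le> 2 * \<tau>\<^sup>2 * (\<tau>\<^sup>2 * (\<Sum>s\<in>y. 1 / d s)) - \<tau>^4 * cov a b a b"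
    using mult_left_mono[OF cv, of "\<tau>^4"] tau by (simp add: power2_eq_square power4_eq_xxxx mult.assoc)
  also have "(\<Sum>s\<in>y. 1 / d s) = (\<Sum>s\<in>y. a s)"
    by (intro sum.cong) (auto simp: a_def)
  finally have "ennreal (\<Sum>s\<in>y. 1 / (1 / \<tau>\<^sup>2 + C * real (hist_count Nn yh s)))
     \<le> ennreal (2 * \<tau>\<^sup>2 * (\<tau>\<^sup>2 * (\<Sum>s\<in>y. a s)) - \<tau>^4 * cov a b a b)"
    by (rule ennreal_leI)
  also have "\<dots> \<le> (\<integral>\<^sup>+w. ennreal ((k (obs yh w) - (\<Sum>s\<in>y. fst w s))\<^sup>2) \<partial>Om)"
    by (rule bayes_risk_ge_of_uncorrelated[OF y k]) (auto simp: sb x_def)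
  finally show ?thesis .
qed

text \<open>The estimation error is \<open>lin a b\<close> with weight \<phi> - 1 on \<theta> and
  \<phi> / N on the errors of the N trips through the segment. Its variance is at most a sum over
  the route of \<tau>^2 (1 - \<phi>)^2 + C \<phi>^2 / N, and the assumption on \<phi> makes both
  terms of order 1 / (1 + N).\<close>

lemma seg_est_risk_le:
  assumes y: "y \<subseteq> S" and phi0: "\<And>s. \<phi> s 0 = 0"
    and phi: "\<And>s j. s \<in> S \<Longrightarrow> j \<ge> 1 \<Longrightarrow> \<bar>1 - \<phi> s j\<bar> \<le> A / sqrt (real j)"
    and row: "\<And>s. s \<in> S \<Longrightarrow> (\<Sum>t\<in>S. \<bar>\<sigma> s t\<bar>) \<le> C" and C: "C \<ge> 0" and A: "A \<ge> 0"
  shows "(\<integral>\<^sup>+w. ennreal ((seg_est Nn \<mu> \<phi> (restrict yh {..<Nn}, y, obs yh w) - (\<Sum>s\<in>y. fst w s))\<^sup>2) \<partial>Om)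
     \<le> ennreal (2 * (\<tau>\<^sup>2 * (1 + A\<^sup>2) + C * (1 + A)\<^sup>2) * (\<Sum>s\<in>y. 1 / (1 + real (hist_count Nn yh s))))"
proof -
  define h where "h s = hist_count Nn yh s" for s
  define f where "f s = \<phi> s (h s)" for s
  define a where "a s = (if s \<in> y then f s - 1 else 0)" for s
  define b where "b n s = (if s \<in> y \<and> s \<in> yh n then f s / real (h s) else 0)" for n s
  have hr: "hist_count Nn (restrict yh {..<Nn}) s = h s" for s
    unfolding h_def hist_count_def by (rule arg_cong[where f=card]) auto
  have nr: "{n. n < Nn \<and> s \<in> restrict yh {..<Nn} n} = {n. n < Nn \<and> s \<in> yh n}" for s by auto
  have err: "seg_est Nn \<mu> \<phi> (restrict yh {..<Nn}, y, obs yh w) - (\<Sum>s\<in>y. fst w s) = lin a b w" for w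
  proof -
    have "seg_est Nn \<mu> \<phi> (restrict yh {..<Nn}, y, obs yh w) - (\<Sum>s\<in>y. fst w s)
       = (\<Sum>s\<in>y. (1 - f s) * \<mu> + f s * ((\<Sum>n\<in>{n. n < Nn \<and> s \<in> yh n}. obs yh w n s) / real (h s)) - fst w s)"
      unfolding seg_est_def prod.case hr nr f_def[symmetric] by (simp only: sum_subtractf)
    also have "\<dots> = (\<Sum>s\<in>y. a s * (fst w s - \<mu>) + (\<Sum>n<Nn. b n s * snd w n s))"
    proof (intro sum.cong refl)
      fix s assume s: "s \<in> y"
      with y have sS: "s \<in> S" by auto
      have o: "(\<Sum>n\<in>{n. n < Nn \<and> s \<in> yh n}. obs yh w n s) = real (h s) * fst w s + (\<Sum>n\<in>{n. n < Nn \<and> s \<in> yh n}. snd w n s)"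
      proof -
        have "(\<Sum>n\<in>{n. n < Nn \<and> s \<in> yh n}. obs yh w n s) = (\<Sum>n\<in>{n. n < Nn \<and> s \<in> yh n}. fst w s + snd w n s)"
          using sS by (intro sum.cong) (auto simp: obs_def)
        then show ?thesis by (simp add: sum.distrib h_def hist_count_def)
      qed
      have "(\<Sum>n<Nn. b n s * snd w n s) = (\<Sum>n\<in>{..<Nn}. if s \<in> yh n then f s / real (h s) * snd w n s else 0)"
        using s by (intro sum.cong) (auto simp: b_def)
      also have "\<dots> = (\<Sum>n\<in>{n\<in>{..<Nn}. s \<in> yh n}. f s / real (h s) * snd w n s)"
        by (rule sum.inter_filter[symmetric]) simp
      also have "{n\<in>{..<Nn}. s \<in> yh n} = {n. n < Nn \<and> s \<in> yh n}" by auto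
      finally have e: "(\<Sum>n<Nn. b n s * snd w n s) = f s / real (h s) * (\<Sum>n\<in>{n. n < Nn \<and> s \<in> yh n}. snd w n s)"
        by (simp only: sum_distrib_left)
      show "(1 - f s) * \<mu> + f s * ((\<Sum>n\<in>{n. n < Nn \<and> s \<in> yh n}. obs yh w n s) / real (h s)) - fst w s
         = a s * (fst w s - \<mu>) + (\<Sum>n<Nn. b n s * snd w n s)"
      proof (cases "h s = 0")
        \<comment> \<open>On an untraversed segment \<phi> = 0 leaves only the prior mean and
          removes the quotient by zero.\<close>
        case True
        then have "f s = 0" using phi0 by (simp add: f_def)
        then show ?thesis unfolding e using s by (simp add: a_def)
      next
        case False
        then show ?thesis unfolding e o using s by (simp add: a_def field_simps)
      qed
    qed
    also have "\<dots> = (\<Sum>s\<in>S. a s * (fst w s - \<mu>) + (\<Sum>n<Nn. b n s * snd w n s))"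
      using y by (intro sum.mono_neutral_left) (auto simp: a_def b_def)
    also have "\<dots> = lin a b w"
      unfolding lin_def by (simp add: sum.distrib sum.swap[of _ S])
    finally show ?thesis .
  qed
  have "(\<integral>\<^sup>+w. ennreal ((lin a b w)\<^sup>2) \<partial>Om) = ennreal (cov a b a b)"
    using lin_square[of a b] by (simp add: has_bochner_integral_iff nn_integral_eq_integral)
  also have "cov a b a b \<le> 2 * (\<tau>\<^sup>2 * (1 + A\<^sup>2) + C * (1 + A)\<^sup>2) * (\<Sum>s\<in>y. 1 / (1 + real (h s)))"
  proof -
    have "cov a b a b \<le> \<tau>\<^sup>2 * (\<Sum>s\<in>S. a s * a s) + (\<Sum>n<Nn. C * (\<Sum>s\<in>S. (b n s)\<^sup>2))"
      unfolding cov_def by (intro add_left_mono sum_mono quad_le_row_sum sym row) auto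
    also have "(\<Sum>n<Nn. C * (\<Sum>s\<in>S. (b n s)\<^sup>2)) = (\<Sum>s\<in>S. \<Sum>n<Nn. C * (b n s)\<^sup>2)"
      by (subst sum.swap) (simp add: sum_distrib_left)
    also have "\<dots> = (\<Sum>s\<in>S. C * ((if s \<in> y then f s / real (h s) else 0)\<^sup>2 * real (h s)))"
      unfolding h_def hist_count_eq_sum sum_distrib_left
      by (intro sum.cong refl) (auto simp: b_def h_def hist_count_eq_sum)
    also have "\<tau>\<^sup>2 * (\<Sum>s\<in>S. a s * a s) + \<dots>
       = (\<Sum>s\<in>S. \<tau>\<^sup>2 * (a s)\<^sup>2 + C * ((if s \<in> y then f s / real (h s) else 0)\<^sup>2 * real (h s)))"
      by (simp add: sum.distrib sum_distrib_left power2_eq_square)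
    also have "\<dots> = (\<Sum>s\<in>S. if s \<in> y then \<tau>\<^sup>2 * (1 - f s)\<^sup>2 + C * ((f s)\<^sup>2 / real (h s)) else 0)"
    proof (intro sum.cong refl)
      fix s
      have "(f s / real (h s))\<^sup>2 * real (h s) = (f s)\<^sup>2 / real (h s)"
        by (cases "h s = 0") (auto simp: power_divide power2_eq_square)
      then show "\<tau>\<^sup>2 * (a s)\<^sup>2 + C * ((if s \<in> y then f s / real (h s) else 0)\<^sup>2 * real (h s))
          = (if s \<in> y then \<tau>\<^sup>2 * (1 - f s)\<^sup>2 + C * ((f s)\<^sup>2 / real (h s)) else 0)"
        by (simp add: a_def power2_commute[of "f s"])
    qed
    also have "\<dots> = (\<Sum>s\<in>y. \<tau>\<^sup>2 * (1 - f s)\<^sup>2 + C * ((f s)\<^sup>2 / real (h s)))"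
      using y by (subst sum.inter_restrict[symmetric]) (auto simp: Int_absorb1)
    also have "\<dots> \<le> (\<Sum>s\<in>y. 2 * (\<tau>\<^sup>2 * (1 + A\<^sup>2) + C * (1 + A)\<^sup>2) * (1 / (1 + real (h s))))"
    proof (intro sum_mono)
      fix s assume "s \<in> y"
      with y have sS: "s \<in> S" by auto
      show "\<tau>\<^sup>2 * (1 - f s)\<^sup>2 + C * ((f s)\<^sup>2 / real (h s)) \<le> 2 * (\<tau>\<^sup>2 * (1 + A\<^sup>2) + C * (1 + A)\<^sup>2) * (1 / (1 + real (h s)))"
      proof (cases "h s = 0")
        case True
        then have "f s = 0" using phi0 by (simp add: f_def)
        moreover have "0 \<le> \<tau>\<^sup>2 * A\<^sup>2" "0 \<le> C * (1 + A)\<^sup>2" "0 \<le> \<tau>\<^sup>2" using C by auto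
        ultimately show ?thesis using True by (simp add: algebra_simps)
      next
        case False
        then have h1: "real (h s) \<ge> 1" by simp
        have p: "\<bar>1 - f s\<bar> \<le> A / sqrt (real (h s))"
          using phi[OF sS, of "h s"] False by (simp add: f_def)
        then have "\<bar>1 - f s\<bar>\<^sup>2 \<le> (A / sqrt (real (h s)))\<^sup>2"
          by (intro power_mono) auto
        then have 1: "(1 - f s)\<^sup>2 \<le> A\<^sup>2 / real (h s)"
          using h1 by (simp add: power_divide)
        have "A / sqrt (real (h s)) \<le> A"
          using A h1 mult_left_mono[of 1 "sqrt (real (h s))" A] by (simp add: divide_le_eq)
        then have "\<bar>f s\<bar> \<le> 1 + A" using p by linarith
        then have "\<bar>f s\<bar>\<^sup>2 \<le> (1 + A)\<^sup>2" by (intro power_mono) auto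
        then have 2: "(f s)\<^sup>2 / real (h s) \<le> (1 + A)\<^sup>2 / real (h s)"
          by (intro divide_right_mono) auto
        have "A\<^sup>2 / real (h s) \<le> (1 + A\<^sup>2) / real (h s)" by (intro divide_right_mono) auto
        with 1 have 1: "(1 - f s)\<^sup>2 \<le> (1 + A\<^sup>2) / real (h s)" by linarith
        have "\<tau>\<^sup>2 * (1 - f s)\<^sup>2 + C * ((f s)\<^sup>2 / real (h s)) \<le> \<tau>\<^sup>2 * ((1 + A\<^sup>2) / real (h s)) + C * ((1 + A)\<^sup>2 / real (h s))"
          using 1 2 C by (intro add_mono mult_left_mono) auto
        also have "\<dots> = (\<tau>\<^sup>2 * (1 + A\<^sup>2) + C * (1 + A)\<^sup>2) * (1 / real (h s))"
          using h1 by (simp add: field_simps)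
        \<comment> \<open>For N \<ge> 1, 1 / N \<le> 2 / (1 + N): the origin of the factor 2 in the
          bound.\<close>
        also have "\<dots> \<le> (\<tau>\<^sup>2 * (1 + A\<^sup>2) + C * (1 + A)\<^sup>2) * (2 / (1 + real (h s)))"
          using h1 C by (intro mult_left_mono add_nonneg_nonneg mult_nonneg_nonneg) (auto simp: field_simps)
        finally show ?thesis by (simp add: mult_ac)
      qed
    qed
    finally show ?thesis by (simp only: sum_distrib_left)
  qed
  finally show ?thesis
    unfolding err h_def by (simp add: ennreal_leI)
qed

end

section \<open>Route probabilities\<close>

lemma finite_segments[simp]: "finite (segments p)"
  by (rule finite_subset[of _ "vertices p \<times> vertices p"]) (auto simp: segments_def vertices_def)

lemma ndiff_eq: "ndiff x y = (x - y) + (y - x)"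
  by (simp add: ndiff_def)

lemma l1_triangle: "l1 a c \<le> l1 a b + l1 b c"
  by (auto simp: l1_def ndiff_def)

lemma l1_self[simp]: "l1 a a = 0"
  by (simp add: l1_def ndiff_def)

lemma edges_Cons: "ws \<noteq> [] \<Longrightarrow> edges (a # ws) = (a, hd ws) # edges ws"
  by (cases ws) (auto simp: edges_def)

lemma edges_singleton[simp]: "edges [a] = []"
  by (simp add: edges_def)

lemma l1_le_length_edges:
  "vs \<noteq> [] \<Longrightarrow> set (edges vs) \<subseteq> segments p \<Longrightarrow> l1 (hd vs) (last vs) \<le> length (edges vs)"
proof (induction vs)
  case (Cons a ws)
  show ?case
  proof (cases "ws = []")
    case False
    have "l1 a (last ws) \<le> l1 a (hd ws) + l1 (hd ws) (last ws)" by (rule l1_triangle)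
    moreover have "l1 a (hd ws) = 1"
      using Cons.prems False by (auto simp: edges_Cons segments_def)
    ultimately show ?thesis
      using Cons False by (simp add: edges_Cons)
  qed simp
qed simp

text \<open>Induction on the distance. Existence makes the sets of minimum-turn routes nonempty, so
  that the uniform distribution on them is meaningful.\<close>

lemma shortest_path_exists:
  assumes "a \<in> vertices p" "b \<in> vertices p"
  shows "shortest_paths p a b \<noteq> {}"
  using assms
proof (induction "l1 a b" arbitrary: a)
  case 0
  then have "a = b" by (auto simp: l1_def ndiff_def prod_eq_iff split: if_splits)
  then have "[a] \<in> shortest_paths p a b" by (simp add: shortest_paths_def)
  then show ?case by auto
next
  case (Suc n)
  obtain i j where a: "a = (i, j)" by (cases a)
  obtain i' j' where b: "b = (i', j')" by (cases b)
  \<comment> \<open>The next vertex corrects the first coordinate before the second. In the last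
    branch j' < j, because the distance is positive.\<close>
  define c where "c = (if i < i' then (Suc i, j) else if i' < i then (i - 1, j)
     else if j < j' then (i, Suc j) else (i, j - 1))"
  have n: "l1 (i, j) (i', j') = Suc n" and v: "i \<le> p" "j \<le> p" "i' \<le> p" "j' \<le> p"
    using Suc.prems Suc.hyps(2) by (auto simp: a b vertices_def)
  consider "i < i'" | "i' < i" | "i = i'" "j < j'" | "i = i'" "j' < j" | "i = i'" "j = j'"
    by linarith
  then have c: "c \<in> vertices p \<and> l1 a c = 1 \<and> l1 c b = n"
    using n v by cases (auto simp: a b c_def vertices_def l1_def ndiff_eq)
  then obtain ws where ws: "ws \<in> shortest_paths p c b"
    using Suc.hyps(1)[of c] Suc.prems by auto
  then have "a # ws \<in> shortest_paths p a b"
    using c Suc.prems Suc.hyps(2) by (auto simp: shortest_paths_def edges_Cons segments_def)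
  then show ?case by auto
qed

lemma min_turn_routes_subset: "y \<in> min_turn_routes p a b \<Longrightarrow> y \<subseteq> segments p"
  by (auto simp: min_turn_routes_def shortest_paths_def)

lemma finite_min_turn_routes: "finite (min_turn_routes p a b)"
  by (rule finite_subset[of _ "Pow (segments p)"]) (auto dest: min_turn_routes_subset)

lemma min_turn_routes_nonempty:
  assumes "a \<in> vertices p" "b \<in> vertices p"
  shows "min_turn_routes p a b \<noteq> {}"
proof -
  obtain vs where "vs \<in> shortest_paths p a b"
    using shortest_path_exists[OF assms] by auto
  from ex_has_least_nat[where P="\<lambda>v. v \<in> shortest_paths p a b" and m=turns, OF this]
  show ?thesis unfolding min_turn_routes_def by blast
qed

text \<open>A shortest path between two vertices of a grid line cannot leave that line, so it
  traverses every segment in between. This is the source of the lower bound on traversal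
  probabilities.\<close>

lemma straight_path_edges:
  assumes "vs \<in> shortest_paths p (i1, j) (i2, j)" "i1 \<le> i" "i < i2"
  shows "((i, j), (Suc i, j)) \<in> set (edges vs)"
  using assms
proof (induction vs arbitrary: i1)
  case Nil then show ?case by (simp add: shortest_paths_def)
next
  case (Cons a ws)
  have a: "a = (i1, j)" using Cons.prems by (simp add: shortest_paths_def)
  have ne: "ws \<noteq> []" using Cons.prems by (auto simp: shortest_paths_def)
  obtain k l where kl: "hd ws = (k, l)" by (cases "hd ws")
  have w: "last ws = (i2, j)" "set (edges ws) \<subseteq> segments p" "Suc (length (edges ws)) = l1 (i1, j) (i2, j)"
      "((i1, j), (k, l)) \<in> segments p"
    using Cons.prems ne kl a by (auto simp: shortest_paths_def edges_Cons)
  have le: "l1 (k, l) (i2, j) \<le> length (edges ws)"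
    using l1_le_length_edges[OF ne w(2)] w(1) kl by simp
  \<comment> \<open>The remaining path has one edge fewer than the initial distance, so the first
    step must reduce the distance; only one neighbour does.\<close>
  have "k = Suc i1 \<and> l = j"
    using le w(3,4) Cons.prems by (auto simp: l1_def ndiff_def segments_def split: if_splits)
  then have k: "k = Suc i1" "l = j" by auto
  show ?case
  proof (cases "i = i1")
    case True
    then show ?thesis using ne kl k a by (simp add: edges_Cons)
  next
    case False
    have "length (edges ws) = l1 (Suc i1, j) (i2, j)"
      using w(3) Cons.prems by (auto simp: l1_def ndiff_def)
    then have "ws \<in> shortest_paths p (Suc i1, j) (i2, j)"
      using ne w kl k by (simp add: shortest_paths_def)
    then show ?thesis
      using Cons.IH[of "Suc i1"] Cons.prems False ne by (simp add: edges_Cons)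
  qed
qed

section \<open>Beta-binomial weights\<close>

lemma betabin_weight:
  assumes "\<alpha> > 0" "k \<le> p"
  shows "real (p choose k) * Beta (\<alpha> + real k) (\<alpha> + real p - real k) / Beta \<alpha> \<alpha>
    = real (p choose k) * pochhammer \<alpha> k * pochhammer \<alpha> (p - k) / pochhammer (\<alpha> + \<alpha>) p"
proof -
  have n: "\<alpha> \<notin> \<int>\<^sub>\<le>\<^sub>0" "\<alpha> + \<alpha> \<notin> \<int>\<^sub>\<le>\<^sub>0"
    using assms(1) by (auto elim!: nonpos_Ints_cases)
  have G: "Gamma \<alpha> > 0" "Gamma (\<alpha> + \<alpha>) > 0" using assms by (auto intro!: Gamma_real_pos)
  have 1: "Gamma (\<alpha> + real k) = pochhammer \<alpha> k * Gamma \<alpha>"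
    using pochhammer_Gamma[OF n(1), of k] assms G by (simp add: field_simps)
  have 2: "Gamma (\<alpha> + real p - real k) = pochhammer \<alpha> (p - k) * Gamma \<alpha>"
    using pochhammer_Gamma[OF n(1), of "p - k"] assms G
    by (simp add: field_simps of_nat_diff)
  have 3: "Gamma (\<alpha> + \<alpha> + real p) = pochhammer (\<alpha> + \<alpha>) p * Gamma (\<alpha> + \<alpha>)"
    using G(2) by (subst pochhammer_Gamma[OF n(2)]) simp
  have "\<alpha> + real k + (\<alpha> + real p - real k) = \<alpha> + \<alpha> + real p" by simp
  then have "Beta (\<alpha> + real k) (\<alpha> + real p - real k)
     = pochhammer \<alpha> k * Gamma \<alpha> * (pochhammer \<alpha> (p - k) * Gamma \<alpha>) / (pochhammer (\<alpha> + \<alpha>) p * Gamma (\<alpha> + \<alpha>))"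
    unfolding Beta_def by (simp only: 1 2 3)
  note B = this
  have P: "pochhammer (\<alpha> + \<alpha>) p > 0" using assms by (intro pochhammer_pos) auto
  \<comment> \<open>The cancellation of the Gamma factors, stated for arbitrary positive
    reals.\<close>
  have "c * (A * g * (B * g) / (Q * X)) / (g * g / X) = c * A * B / Q"
    if "g > 0" "X > 0" "Q > 0" for c A B Q g X :: real
    using that by (simp add: field_simps)
  from this[OF G P] show ?thesis
    unfolding B unfolding Beta_def .
qed

text \<open>\<open>embed_pmf\<close> has the given weights only if they sum to 1. In Pochhammer form
  this is the binomial theorem for rising factorials.\<close>

lemma pmf_betabin:
  assumes a: "\<alpha> > 0"
  shows "pmf (betabin_pmf \<alpha> p) k = (if k \<le> p then
     real (p choose k) * pochhammer \<alpha> k * pochhammer \<alpha> (p - k) / pochhammer (\<alpha> + \<alpha>) p else 0)"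
proof -
  define f where "f k = (if k \<le> p then
      real (p choose k) * Beta (\<alpha> + real k) (\<alpha> + real p - real k) / Beta \<alpha> \<alpha> else 0)" for k
  have f: "f k = (if k \<le> p then
     real (p choose k) * pochhammer \<alpha> k * pochhammer \<alpha> (p - k) / pochhammer (\<alpha> + \<alpha>) p else 0)" for k
    unfolding f_def using betabin_weight[OF a] by auto
  have nn: "f k \<ge> 0" for k
    unfolding f using a by (auto intro!: divide_nonneg_nonneg mult_nonneg_nonneg less_imp_le[OF pochhammer_pos])
  have pos: "pochhammer (\<alpha> + \<alpha>) p > 0" using a by (intro pochhammer_pos) auto
  have "(\<integral>\<^sup>+k. ennreal (f k) \<partial>count_space UNIV) = (\<integral>\<^sup>+k. ennreal (f k) \<partial>count_space {..p})"
    by (rule nn_integral_count_space_eq) (auto simp: f)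
  also have "\<dots> = (\<Sum>k\<le>p. ennreal (f k))"
    by (simp add: nn_integral_count_space_finite)
  also have "\<dots> = ennreal (\<Sum>k\<le>p. f k)"
    using nn by (simp add: sum_ennreal)
  also have "(\<Sum>k\<le>p. f k) = (\<Sum>k\<le>p. real (p choose k) * pochhammer \<alpha> k * pochhammer \<alpha> (p - k)) / pochhammer (\<alpha> + \<alpha>) p"
    by (simp add: f sum_divide_distrib)
  also have "\<dots> = 1"
    using pos by (simp add: pochhammer_binomial_sum[symmetric])
  finally have "(\<integral>\<^sup>+k. ennreal (f k) \<partial>count_space UNIV) = 1" by simp
  then have "pmf (embed_pmf f) k = f k"
    using nn by (intro pmf_embed_pmf) auto
  then show ?thesis
    unfolding betabin_pmf_def f_def[abs_def, symmetric] by (simp add: f)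
qed

text \<open>The summand \<open>\<alpha>\<^sup>2\<close> is the offset for which the quotient of the two sides is monotone in \<open>p\<close>.\<close>

lemma pochhammer_square_lower:
  fixes \<alpha> :: real
  assumes a: "0 < \<alpha>" "\<alpha> \<le> 1"
  shows "\<alpha>\<^sup>2 * (pochhammer (\<alpha> + \<alpha>) p * fact p) \<le> (real p + \<alpha>\<^sup>2) * (pochhammer \<alpha> p)\<^sup>2"
proof (induction p)
  case (Suc p)
  let ?q = "real p"
  have "(?q + 1 + \<alpha>\<^sup>2) * (\<alpha> + ?q)\<^sup>2 - (?q + \<alpha>\<^sup>2) * ((?q + 1) * (\<alpha> + \<alpha> + ?q)) = (\<alpha> * (1 - \<alpha>))\<^sup>2"
    by (simp add: power2_eq_square algebra_simps)
  then have key: "(?q + \<alpha>\<^sup>2) * ((?q + 1) * (\<alpha> + \<alpha> + ?q)) \<le> (?q + 1 + \<alpha>\<^sup>2) * (\<alpha> + ?q)\<^sup>2"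
    using zero_le_power2[of "\<alpha> * (1 - \<alpha>)"] by linarith
  have "\<alpha>\<^sup>2 * (pochhammer (\<alpha> + \<alpha>) (Suc p) * fact (Suc p))
     = (\<alpha>\<^sup>2 * (pochhammer (\<alpha> + \<alpha>) p * fact p)) * ((?q + 1) * (\<alpha> + \<alpha> + ?q))"
    by (simp add: pochhammer_Suc algebra_simps)
  also have "\<dots> \<le> ((?q + \<alpha>\<^sup>2) * (pochhammer \<alpha> p)\<^sup>2) * ((?q + 1) * (\<alpha> + \<alpha> + ?q))"
    using a by (intro mult_right_mono Suc.IH) auto
  also have "\<dots> = (pochhammer \<alpha> p)\<^sup>2 * ((?q + \<alpha>\<^sup>2) * ((?q + 1) * (\<alpha> + \<alpha> + ?q)))"
    by (simp only: mult_ac)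
  also have "\<dots> \<le> (pochhammer \<alpha> p)\<^sup>2 * ((?q + 1 + \<alpha>\<^sup>2) * (\<alpha> + ?q)\<^sup>2)"
    by (intro mult_left_mono key) auto
  also have "\<dots> = (real (Suc p) + \<alpha>\<^sup>2) * (pochhammer \<alpha> (Suc p))\<^sup>2"
    by (simp add: pochhammer_Suc power_mult_distrib mult_ac add_ac)
  finally show ?case .
qed simp

text \<open>Consecutive quotients are (\<alpha> + k) / (1 + k), at most 1 because \<alpha> \<le>
  1.\<close>

lemma pochhammer_div_fact_antimono:
  fixes \<alpha> :: real
  assumes a: "0 < \<alpha>" "\<alpha> \<le> 1"
  shows "antimono (\<lambda>k. pochhammer \<alpha> k / fact k)"
proof (rule decseq_SucI)
  fix k
  have "pochhammer \<alpha> (Suc k) / fact (Suc k) = pochhammer \<alpha> k / fact k * ((\<alpha> + real k) / (1 + real k))"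
    by (simp add: pochhammer_Suc field_simps)
  also have "\<dots> \<le> pochhammer \<alpha> k / fact k * 1"
    using a by (intro mult_left_mono divide_nonneg_nonneg less_imp_le[OF pochhammer_pos]) (auto simp: field_simps)
  finally show "pochhammer \<alpha> (Suc k) / fact (Suc k) \<le> pochhammer \<alpha> k / fact k" by simp
qed

text \<open>With w k = pochhammer \<alpha> k / k!, the probability of k is proportional to w k * w
  (p - k). As w decreases, both factors are at least w p, and \<open>pochhammer_square_lower\<close>
  bounds what remains.\<close>

lemma pmf_betabin_ge:
  assumes a: "0 < \<alpha>" "\<alpha> \<le> 1" and k: "k \<le> p"
  shows "\<alpha>\<^sup>2 / (real p + 1) \<le> pmf (betabin_pmf \<alpha> p) k"
proof -
  let ?w = "\<lambda>k. pochhammer \<alpha> k / fact k :: real"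
  have pos: "pochhammer (\<alpha> + \<alpha>) p > 0" using a by (intro pochhammer_pos) auto
  have w0: "?w k \<ge> 0" for k
    using a by (intro divide_nonneg_nonneg less_imp_le[OF pochhammer_pos]) auto
  have "\<alpha>\<^sup>2 * (pochhammer (\<alpha> + \<alpha>) p * fact p) \<le> (real p + \<alpha>\<^sup>2) * (pochhammer \<alpha> p)\<^sup>2"
    by (rule pochhammer_square_lower[OF a])
  also have "\<dots> \<le> (real p + 1) * (pochhammer \<alpha> p)\<^sup>2"
    using a by (intro mult_right_mono) (auto simp: power_le_one)
  finally have "\<alpha>\<^sup>2 / (real p + 1) \<le> (pochhammer \<alpha> p)\<^sup>2 / (pochhammer (\<alpha> + \<alpha>) p * fact p)"
    using pos by (simp add: divide_simps mult_ac)
  also have "\<dots> = fact p * (?w p * ?w p) / pochhammer (\<alpha> + \<alpha>) p"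
    by (simp add: power2_eq_square)
  also have "\<dots> \<le> fact p * (?w k * ?w (p - k)) / pochhammer (\<alpha> + \<alpha>) p"
    using antimonoD[OF pochhammer_div_fact_antimono[OF a], of k p]
      antimonoD[OF pochhammer_div_fact_antimono[OF a], of "p - k" p] k pos w0
    by (intro divide_right_mono mult_left_mono mult_mono) auto
  also have "\<dots> = pmf (betabin_pmf \<alpha> p) k"
    using a k by (simp add: pmf_betabin binomial_fact)
  finally show ?thesis .
qed

section \<open>Probability that a route traverses a given segment\<close>

lemma set_vertex_pmf_subset: "0 < \<alpha> \<Longrightarrow> set_pmf (vertex_pmf \<alpha> p) \<subseteq> vertices p"
  by (auto simp: vertex_pmf_def vertices_def set_pmf_iff pmf_betabin split: if_splits)

lemma pmf_vertex_ge:
  assumes a: "0 < \<alpha>" "\<alpha> \<le> 1" and "i \<le> p" "j \<le> p"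
  shows "(\<alpha>\<^sup>2 / (real p + 1))\<^sup>2 \<le> pmf (vertex_pmf \<alpha> p) (i, j)"
  unfolding vertex_pmf_def pmf_pair power2_eq_square[of "\<alpha>\<^sup>2 / (real p + 1)"]
  using pmf_betabin_ge[OF a] assms by (intro mult_mono) auto

text \<open>Conditioning on distinct endpoints requires an event of positive probability; p \<ge> 1
  provides two distinct vertices.\<close>

lemma od_support:
  assumes a: "0 < \<alpha>" "\<alpha> \<le> 1" and p: "p \<ge> 1"
  shows "set_pmf (pair_pmf (vertex_pmf \<alpha> p) (vertex_pmf \<alpha> p)) \<inter> {(a, b). a \<noteq> b} \<noteq> {}"
proof -
  have pos: "(i, j) \<in> set_pmf (vertex_pmf \<alpha> p)" if "i \<le> p" "j \<le> p" for i j
  proof -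
    have "0 < (\<alpha>\<^sup>2 / (real p + 1))\<^sup>2" using a by simp
    also note pmf_vertex_ge[OF a that]
    finally show ?thesis by (simp add: set_pmf_iff)
  qed
  have "((0, 0), (1, 0)) \<in> set_pmf (pair_pmf (vertex_pmf \<alpha> p) (vertex_pmf \<alpha> p)) \<inter> {(a, b). a \<noteq> b}"
    using p by (auto intro!: pos)
  then show ?thesis by blast
qed

lemma set_route_pmf_subset:
  assumes a: "0 < \<alpha>" "\<alpha> \<le> 1" and p: "p \<ge> 1" and y: "y \<in> set_pmf (route_pmf \<alpha> p)"
  shows "y \<subseteq> segments p"
proof -
  obtain a b where "a \<in> set_pmf (vertex_pmf \<alpha> p)" "b \<in> set_pmf (vertex_pmf \<alpha> p)"
    and y: "y \<in> set_pmf (pmf_of_set (min_turn_routes p a b))"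
    using y od_support[OF a p] unfolding route_pmf_def by (auto simp: set_cond_pmf)
  then have "min_turn_routes p a b \<noteq> {}"
    using set_vertex_pmf_subset[OF a(1), of p] by (intro min_turn_routes_nonempty) auto
  with y show ?thesis
    by (auto simp: finite_min_turn_routes dest: min_turn_routes_subset)
qed

text \<open>There are (i + 1) (p - i) pairs of endpoints on the line that lie on the two sides of
  the segment, and all their routes traverse it. Such a pair fixes four independent coordinates,
  whence the fourth power.\<close>

lemma route_prob_ge:
  assumes a: "0 < \<alpha>" "\<alpha> \<le> 1" and i: "i < p" "j \<le> p"
  shows "real (Suc i) * real (p - i) * (\<alpha>\<^sup>2 / (real p + 1))^4
    \<le> measure_pmf.prob (route_pmf \<alpha> p) {y. ((i, j), (Suc i, j)) \<in> y}"
proof -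
  let ?O = "pair_pmf (vertex_pmf \<alpha> p) (vertex_pmf \<alpha> p)"
  let ?D = "{(a, b). a \<noteq> b} :: (vtx \<times> vtx) set"
  let ?s = "((i, j), (Suc i, j))"
  let ?A = "{0..i} \<times> {Suc i..p}"
  let ?f = "\<lambda>(i1, i2). ((i1, j), (i2, j))"
  let ?E = "?f ` ?A"
  let ?q = "\<alpha>\<^sup>2 / (real p + 1)"
  have supp: "set_pmf ?O \<inter> ?D \<noteq> {}" using od_support[OF a, of p] i by simp
  have inj: "inj_on ?f ?A" by (auto simp: inj_on_def)
  have card: "card ?E = Suc i * (p - i)"
    using i by (simp add: card_image[OF inj] card_cartesian_product)
  have "real (Suc i) * real (p - i) * ?q^4 = (\<Sum>e\<in>?E. ?q^4)"
    by (simp only: sum_constant card of_nat_mult)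
  also have "\<dots> \<le> (\<Sum>e\<in>?E. pmf (cond_pmf ?O ?D) e)"
  proof (intro sum_mono)
    fix e assume e: "e \<in> ?E"
    then obtain i1 i2 where e: "e = ((i1, j), (i2, j))" "i1 \<le> i" "i < i2" "i2 \<le> p" by auto
    have "?q^4 = ?q\<^sup>2 * ?q\<^sup>2" by (simp only: power_add[symmetric]) simp
    also have "\<dots> \<le> pmf ?O e"
      unfolding e(1) pmf_pair
      by (rule mult_mono[OF pmf_vertex_ge[OF a] pmf_vertex_ge[OF a]]) (use e i in auto)
    \<comment> \<open>Conditioning divides by a probability, so it can only increase the weight of a
      pair of distinct endpoints.\<close>
    also have "\<dots> \<le> pmf ?O e / measure_pmf.prob ?O ?D"
    proof -
      obtain z where "z \<in> set_pmf ?O" "z \<in> ?D" using supp by blast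
      then have pos: "measure_pmf.prob ?O ?D > 0" by (rule measure_pmf_posI)
      have "pmf ?O e * measure_pmf.prob ?O ?D \<le> pmf ?O e"
        by (rule mult_left_le[OF measure_pmf.prob_le_1 pmf_nonneg])
      then show ?thesis
        by (simp only: pos_le_divide_eq[OF pos])
    qed
    also have "\<dots> = pmf (cond_pmf ?O ?D) e"
      unfolding pmf_cond[OF supp] using e by simp
    finally show "?q^4 \<le> pmf (cond_pmf ?O ?D) e" .
  qed
  also have "\<dots> = measure_pmf.prob (cond_pmf ?O ?D) ?E"
    by (rule measure_measure_pmf_finite[symmetric]) auto
  also have "\<dots> \<le> measure_pmf.prob (route_pmf \<alpha> p) {y. ?s \<in> y}"
  proof -
    have "emeasure (cond_pmf ?O ?D) ?E = (\<integral>\<^sup>+e. indicator ?E e \<partial>cond_pmf ?O ?D)"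
      by simp
    also have "\<dots> \<le> (\<integral>\<^sup>+e. emeasure ((\<lambda>(a, b). pmf_of_set (min_turn_routes p a b)) e) {y. ?s \<in> y} \<partial>cond_pmf ?O ?D)"
    proof (intro nn_integral_mono)
      fix e
      show "indicator ?E e \<le> emeasure ((\<lambda>(a, b). pmf_of_set (min_turn_routes p a b)) e) {y. ?s \<in> y}"
      proof (cases "e \<in> ?E")
        case True
        then obtain i1 i2 where e: "e = ((i1, j), (i2, j))" "i1 \<le> i" "i < i2" "i2 \<le> p" by auto
        let ?R = "min_turn_routes p (i1, j) (i2, j)"
        have "?R \<noteq> {}"
          using e i by (intro min_turn_routes_nonempty) (auto simp: vertices_def)
        then have "set_pmf (pmf_of_set ?R) = ?R" by (simp add: finite_min_turn_routes)
        moreover have "?R \<subseteq> {y. ?s \<in> y}"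
          using straight_path_edges[OF _ e(2,3)] by (auto simp: min_turn_routes_def)
        ultimately have "AE y in pmf_of_set ?R. y \<in> {y. ?s \<in> y}"
          by (auto simp: AE_measure_pmf_iff)
        then have "emeasure (pmf_of_set ?R) {y. ?s \<in> y} = 1"
          by (intro measure_pmf.emeasure_eq_1_AE) auto
        then show ?thesis by (simp add: e indicator_def)
      qed simp
    qed
    also have "\<dots> = emeasure (route_pmf \<alpha> p) {y. ?s \<in> y}"
      unfolding route_pmf_def by simp
    finally show ?thesis
      by (simp add: measure_pmf.emeasure_eq_measure)
  qed
  finally show ?thesis .
qed

section \<open>Averaging over the routes\<close>

text \<open>Holds for arbitrary f: the integral is a supremum over simple functions below f, and
  Tonelli applies to each of them. It bounds the risk of segment-based estimators without a
  measurability argument.\<close>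

lemma nn_integral_pair_le:
  assumes "sigma_finite_measure M2"
  shows "(\<integral>\<^sup>+z. f z \<partial>(M1 \<Otimes>\<^sub>M M2)) \<le> (\<integral>\<^sup>+x. \<integral>\<^sup>+y. f (x, y) \<partial>M2 \<partial>M1)"
proof -
  interpret sigma_finite_measure M2 by fact
  show ?thesis
    unfolding nn_integral_def[of "M1 \<Otimes>\<^sub>M M2"]
  proof (rule SUP_least)
    fix g assume g: "g \<in> {g. simple_function (M1 \<Otimes>\<^sub>M M2) g \<and> g \<le> f}"
    then have "integral\<^sup>S (M1 \<Otimes>\<^sub>M M2) g = integral\<^sup>N (M1 \<Otimes>\<^sub>M M2) g"
      by (simp add: nn_integral_eq_simple_integral)
    also have "\<dots> = (\<integral>\<^sup>+x. \<integral>\<^sup>+y. g (x, y) \<partial>M2 \<partial>M1)"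
      using g by (intro nn_integral_fst[symmetric] borel_measurable_simple_function) auto
    also have "\<dots> \<le> (\<integral>\<^sup>+x. \<integral>\<^sup>+y. f (x, y) \<partial>M2 \<partial>M1)"
      using g by (intro nn_integral_mono) (auto simp: le_fun_def)
    finally show "integral\<^sup>S (M1 \<Otimes>\<^sub>M M2) g \<le> (\<integral>\<^sup>+x. \<integral>\<^sup>+y. f (x, y) \<partial>M2 \<partial>M1)" .
  qed
qed

definition traverse_prob :: "real \<Rightarrow> nat \<Rightarrow> seg \<Rightarrow> real" where
  "traverse_prob \<alpha> p s = measure_pmf.prob (route_pmf \<alpha> p) {y. s \<in> y}"

definition history :: "real \<Rightarrow> nat \<Rightarrow> nat \<Rightarrow> (nat \<Rightarrow> seg set) measure" where
  "history \<alpha> p Nn = PiM {..<Nn} (\<lambda>_. measure_pmf (route_pmf \<alpha> p))"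

text \<open>The conditional expectation, given the historical routes, of the sum of 1 / (1 + N_s)
  over the predicting route; both risks are compared with its mean.\<close>

definition sparsity :: "real \<Rightarrow> nat \<Rightarrow> nat \<Rightarrow> (nat \<Rightarrow> seg set) \<Rightarrow> real" where
  "sparsity \<alpha> p Nn yh = (\<Sum>s\<in>segments p. traverse_prob \<alpha> p s / (1 + real (hist_count Nn yh s)))"

lemma traverse_prob_nonneg: "traverse_prob \<alpha> p s \<ge> 0"
  by (simp add: traverse_prob_def)

lemma sparsity_nonneg: "sparsity \<alpha> p Nn yh \<ge> 0"
  unfolding sparsity_def by (intro sum_nonneg divide_nonneg_nonneg traverse_prob_nonneg) auto

lemma prob_space_history: "prob_space (history \<alpha> p Nn)"
  unfolding history_def by (intro prob_space_PiM measure_pmf.prob_space_axioms)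

lemma measurable_hist_count[measurable]:
  "(\<lambda>yh. real (hist_count Nn yh s)) \<in> borel_measurable (history \<alpha> p Nn)"
proof -
  have "real (hist_count Nn yh s) = (\<Sum>n<Nn. indicator {y. s \<in> y} (yh n))" for yh
    unfolding hist_count_eq_sum by (intro sum.cong) auto
  moreover have "(\<lambda>yh. \<Sum>n<Nn. indicator {y. s \<in> y} (yh n) :: real) \<in> borel_measurable (history \<alpha> p Nn)"
    unfolding history_def
    by (intro borel_measurable_sum measurable_compose[OF measurable_component_singleton]) auto
  ultimately show ?thesis by simp
qed

lemma measurable_sparsity[measurable]: "sparsity \<alpha> p Nn \<in> borel_measurable (history \<alpha> p Nn)"
  unfolding sparsity_def by measurable

text \<open>Almost every route lies in the finite set of segments, so the random sum is a fixed
  finite sum of indicators.\<close>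

lemma nn_integral_route_sum:
  assumes a: "0 < \<alpha>" "\<alpha> \<le> 1" and p: "p \<ge> 1" and q: "\<And>s. q s \<ge> 0"
  shows "(\<integral>\<^sup>+y. ennreal (\<Sum>s\<in>y. q s) \<partial>route_pmf \<alpha> p) = ennreal (\<Sum>s\<in>segments p. traverse_prob \<alpha> p s * q s)"
proof -
  have "(\<integral>\<^sup>+y. ennreal (\<Sum>s\<in>y. q s) \<partial>route_pmf \<alpha> p)
      = (\<integral>\<^sup>+y. (\<Sum>s\<in>segments p. ennreal (q s) * indicator {y. s \<in> y} y) \<partial>route_pmf \<alpha> p)"
  proof (intro nn_integral_cong_AE, unfold AE_measure_pmf_iff, rule ballI)
    fix y assume "y \<in> set_pmf (route_pmf \<alpha> p)"
    then have y: "y \<subseteq> segments p" by (rule set_route_pmf_subset[OF a p])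
    have "(\<Sum>s\<in>segments p. ennreal (q s) * indicator {y. s \<in> y} y) = (\<Sum>s\<in>segments p. if s \<in> y then ennreal (q s) else 0)"
      by (intro sum.cong) auto
    also have "\<dots> = (\<Sum>s\<in>y. ennreal (q s))"
      using y by (subst sum.inter_restrict[symmetric]) (auto simp: Int_absorb1)
    finally show "ennreal (\<Sum>s\<in>y. q s) = (\<Sum>s\<in>segments p. ennreal (q s) * indicator {y. s \<in> y} y)"
      using q by (simp add: sum_ennreal)
  qed
  also have "\<dots> = (\<Sum>s\<in>segments p. ennreal (q s) * emeasure (route_pmf \<alpha> p) {y. s \<in> y})"
    by (subst nn_integral_sum) (auto simp: nn_integral_cmult_indicator)
  also have "\<dots> = (\<Sum>s\<in>segments p. ennreal (traverse_prob \<alpha> p s * q s))"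
    using q by (intro sum.cong refl)
      (simp add: traverse_prob_def measure_pmf.emeasure_eq_measure ennreal_mult' mult.commute)
  also have "\<dots> = ennreal (\<Sum>s\<in>segments p. traverse_prob \<alpha> p s * q s)"
    using q traverse_prob_nonneg by (intro sum_ennreal) auto
  finally show ?thesis .
qed

lemma expectation_hist_count:
  "has_bochner_integral (history \<alpha> p Nn) (\<lambda>yh. real (hist_count Nn yh s)) (real Nn * traverse_prob \<alpha> p s)"
proof -
  let ?H = "history \<alpha> p Nn"
  interpret prob_space ?H by (rule prob_space_history)
  have hc: "real (hist_count Nn yh s) = (\<Sum>n<Nn. indicator {y. s \<in> y} (yh n))" for yh
    unfolding hist_count_eq_sum by (intro sum.cong) auto
  have "has_bochner_integral ?H (\<lambda>yh. indicator {y. s \<in> y} (yh n)) (traverse_prob \<alpha> p s)" if n: "n \<in> {..<Nn}" for n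
  proof -
    have d: "distr ?H (measure_pmf (route_pmf \<alpha> p)) (\<lambda>yh. yh n) = measure_pmf (route_pmf \<alpha> p)"
      unfolding history_def using n
      by (intro distr_PiM_component[where M="\<lambda>_. measure_pmf (route_pmf \<alpha> p)"] measure_pmf.prob_space_axioms)
    have m: "(\<lambda>yh. yh n) \<in> measurable ?H (measure_pmf (route_pmf \<alpha> p))"
      unfolding history_def using n by (rule measurable_component_singleton)
    have "(\<integral>y. indicator {y. s \<in> y} y \<partial>distr ?H (measure_pmf (route_pmf \<alpha> p)) (\<lambda>yh. yh n)) = traverse_prob \<alpha> p s"
      unfolding d by (simp add: traverse_prob_def)
    then have "(\<integral>yh. indicator {y. s \<in> y} (yh n) \<partial>?H) = traverse_prob \<alpha> p s"
      by (subst (asm) integral_distr[OF m]) auto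
    moreover have "integrable ?H (\<lambda>yh. indicator {y. s \<in> y} (yh n) :: real)"
      using measurable_compose[OF m, of "indicator {y. s \<in> y}" borel]
      by (intro integrable_const_bound[where B=1]) auto
    ultimately show ?thesis by (simp add: has_bochner_integral_iff)
  qed
  then have "has_bochner_integral ?H (\<lambda>yh. \<Sum>n<Nn. indicator {y. s \<in> y} (yh n)) (\<Sum>n<Nn. traverse_prob \<alpha> p s)"
    by (intro has_bochner_integral_sum) auto
  then show ?thesis by (simp add: hc)
qed

text \<open>Jensen's inequality by way of the tangent: 1 / (1 + x) lies above its tangent at the
  mean of N_s, where 1 + x equals \<open>w\<close>; the gap is a square over a positive
  number.\<close>

lemma expectation_inverse_hist_count_ge:
  shows "integrable (history \<alpha> p Nn) (\<lambda>yh. 1 / (1 + real (hist_count Nn yh s)))"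
    and "1 / (1 + real Nn * traverse_prob \<alpha> p s) \<le> (\<integral>yh. 1 / (1 + real (hist_count Nn yh s)) \<partial>history \<alpha> p Nn)"
proof -
  let ?H = "history \<alpha> p Nn"
  interpret prob_space ?H by (rule prob_space_history)
  let ?h = "\<lambda>yh. real (hist_count Nn yh s)"
  define w where "w = 1 + real Nn * traverse_prob \<alpha> p s"
  have w: "w > 0" unfolding w_def using traverse_prob_nonneg by (intro add_pos_nonneg) auto
  show i: "integrable ?H (\<lambda>yh. 1 / (1 + ?h yh))"
    by (intro integrable_const_bound[where B=1]) (auto intro!: AE_I2)
  note h = expectation_hist_count[of \<alpha> p Nn s]
  have tangent: "2 / w - (1 + x) / w\<^sup>2 \<le> 1 / (1 + x)" if "x \<ge> 0" for x :: real
  proof -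
    have "1 / (1 + x) - (2 / w - (1 + x) / w\<^sup>2) = (w - (1 + x))\<^sup>2 / (w\<^sup>2 * (1 + x))"
      using w that by (simp add: field_simps power2_eq_square)
    also have "\<dots> \<ge> 0" using that by auto
    finally show ?thesis by simp
  qed
  have "1 / w = 2 / w - w / w\<^sup>2"
    using w by (simp add: field_simps power2_eq_square)
  also have "\<dots> = (\<integral>yh. 2 / w - (1 + ?h yh) / w\<^sup>2 \<partial>?H)"
    using h by (simp add: has_bochner_integral_iff prob_space w_def)
  also have "\<dots> \<le> (\<integral>yh. 1 / (1 + ?h yh) \<partial>?H)"
    using h i by (intro integral_mono tangent) (auto simp: has_bochner_integral_iff)
  finally show "1 / (1 + real Nn * traverse_prob \<alpha> p s) \<le> (\<integral>yh. 1 / (1 + ?h yh) \<partial>?H)"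
    by (simp add: w_def)
qed

lemma expectation_sparsity_ge:
  "ennreal (\<Sum>s\<in>segments p. traverse_prob \<alpha> p s / (1 + real Nn * traverse_prob \<alpha> p s))
    \<le> (\<integral>\<^sup>+yh. ennreal (sparsity \<alpha> p Nn yh) \<partial>history \<alpha> p Nn)"
proof -
  note e = expectation_inverse_hist_count_ge[where \<alpha>=\<alpha> and p=p and Nn=Nn]
  have i: "integrable (history \<alpha> p Nn) (\<lambda>yh. traverse_prob \<alpha> p s * (1 / (1 + real (hist_count Nn yh s))))" for s
    using e(1) by (rule integrable_mult_right)
  have "(\<Sum>s\<in>segments p. traverse_prob \<alpha> p s * (1 / (1 + real Nn * traverse_prob \<alpha> p s)))
     \<le> (\<Sum>s\<in>segments p. traverse_prob \<alpha> p s * (\<integral>yh. 1 / (1 + real (hist_count Nn yh s)) \<partial>history \<alpha> p Nn))"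
    by (intro sum_mono mult_left_mono e traverse_prob_nonneg)
  also have "\<dots> = (\<integral>yh. (\<Sum>s\<in>segments p. traverse_prob \<alpha> p s * (1 / (1 + real (hist_count Nn yh s)))) \<partial>history \<alpha> p Nn)"
    by (simp only: Bochner_Integration.integral_sum[OF i] integral_mult_right_zero)
  finally have *: "(\<Sum>s\<in>segments p. traverse_prob \<alpha> p s / (1 + real Nn * traverse_prob \<alpha> p s))
     \<le> (\<integral>yh. sparsity \<alpha> p Nn yh \<partial>history \<alpha> p Nn)"
    by (simp add: sparsity_def)
  have "integrable (history \<alpha> p Nn) (\<lambda>yh. \<Sum>s\<in>segments p. traverse_prob \<alpha> p s * (1 / (1 + real (hist_count Nn yh s))))"
    by (intro Bochner_Integration.integrable_sum i)
  then have "integrable (history \<alpha> p Nn) (sparsity \<alpha> p Nn)"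
    by (simp add: sparsity_def[abs_def])
  then show ?thesis
    using * sparsity_nonneg by (subst nn_integral_eq_integral) (auto intro: ennreal_leI)
qed

text \<open>Only segments in the first direction whose first coordinate lies in the middle third are
  kept. For them p_s is at least \<open>x\<close>, of order 1 / p^2, and there are m (p + 1) of
  them. As u / (1 + N u) increases in u and N x \<le> K, each contributes at least x / (1 +
  K).\<close>

lemma sum_traverse_prob_ge:
  assumes a: "0 < \<alpha>" "\<alpha> \<le> 1" and p: "p \<ge> 3" and N: "real Nn \<le> K * real p" and K: "K \<ge> 0"
  shows "\<alpha>^8 / (216 * (1 + K)) \<le> (\<Sum>s\<in>segments p. traverse_prob \<alpha> p s / (1 + real Nn * traverse_prob \<alpha> p s))"
proof -
  define m where "m = p div 3"
  \<comment> \<open>The bound of \<open>route_prob_ge\<close> with both counting factors replaced by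
    (p + 1) / 6.\<close>
  define x where "x = \<alpha>^8 / 36 / (real p + 1)\<^sup>2"
  define f where "f = (\<lambda>(i, j). ((i, j), (Suc i, j)) :: seg)"
  let ?A = "{m..<2*m} \<times> {0..p}"
  let ?g = "\<lambda>u. u / (1 + real Nn * u)"
  have x0: "x > 0" unfolding x_def using a by simp
  have m6: "real p + 1 \<le> 6 * real m"
  proof -
    \<comment> \<open>From p \<le> 3 m + 2 and m \<ge> 1; this is where p \<ge> 3 enters.\<close>
    have "p + 1 \<le> 6 * m" unfolding m_def using p by presburger
    then show ?thesis by linarith
  qed
  have m3: "3 * m \<le> p" unfolding m_def by simp
  have inj: "inj_on f ?A" by (auto simp: f_def inj_on_def)
  have sub: "f ` ?A \<subseteq> segments p"
    using m3 by (auto simp: f_def segments_def vertices_def l1_def ndiff_def)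
  have g_mono: "?g u \<le> ?g v" if "0 \<le> u" "u \<le> v" for u v :: real
  proof -
    have "0 < 1 + real Nn * u" "0 < 1 + real Nn * v" using that by (auto intro!: add_pos_nonneg)
    then show ?thesis using that by (simp add: divide_simps algebra_simps)
  qed
  have ge: "x \<le> traverse_prob \<alpha> p (f ij)" if ij: "ij \<in> ?A" for ij
  proof -
    obtain i j where [simp]: "ij = (i, j)" by (cases ij)
    have i: "m \<le> i" "i < 2 * m" "j \<le> p" using ij by auto
    have "x = ((real p + 1) / 6)\<^sup>2 * (\<alpha>\<^sup>2 / (real p + 1))^4"
    proof -
      define P where "P = real p + 1"
      have "P > 0" by (simp add: P_def)
      have "\<alpha>^8 = (\<alpha>\<^sup>2)^4" by (simp flip: power_mult)
      then show ?thesis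
        unfolding x_def P_def[symmetric] using \<open>P > 0\<close>
        by (simp add: power_divide field_simps power2_eq_square power4_eq_xxxx)
    qed
    also have "\<dots> \<le> (real m)\<^sup>2 * (\<alpha>\<^sup>2 / (real p + 1))^4"
      using m6 by (intro mult_right_mono power_mono) auto
    also have "(real m)\<^sup>2 \<le> real (Suc i) * real (p - i)"
    proof -
      have "real m \<le> real (Suc i)" "real m \<le> real (p - i)" using i m3 by linarith+
      then show ?thesis unfolding power2_eq_square by (intro mult_mono) auto
    qed
    also have "real (Suc i) * real (p - i) * (\<alpha>\<^sup>2 / (real p + 1))^4 \<le> traverse_prob \<alpha> p (f ij)"
      using route_prob_ge[OF a, of i p j] i m3 by (simp add: traverse_prob_def f_def)
    finally show ?thesis by (simp add: mult_right_mono)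
  qed
  have Nx: "real Nn * x \<le> K"
  proof -
    have "real Nn * x \<le> K * real p * x" using N x0 by (intro mult_right_mono) auto
    also have "\<dots> = K * (real p * x)" by simp
    also have "real p * x \<le> 1"
    proof -
      have "\<alpha>^8 \<le> 1" using a by (intro power_le_one) auto
      then have "x \<le> 1 / (real p + 1)\<^sup>2"
        unfolding x_def by (intro divide_right_mono) auto
      then have "real p * x \<le> real p * (1 / (real p + 1)\<^sup>2)" by (intro mult_left_mono) auto
      also have "\<dots> \<le> 1" by (simp add: divide_simps power2_eq_square algebra_simps)
      finally show ?thesis .
    qed
    finally show ?thesis using K by (simp add: mult_left_mono)
  qed
  \<comment> \<open>Here 216 = 6 * 36: a 6 from the number of segments, and 36 from
    \<open>x\<close>.\<close>
  have "z / (216 * L) = P / 6 * P * (z / 36 / P\<^sup>2 / L)" if "P > 0" "L > 0" for z P L :: real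
    using that by (simp add: field_simps power2_eq_square)
  from this[of "real p + 1" "1 + K" "\<alpha>^8"]
  have "\<alpha>^8 / (216 * (1 + K)) = (real p + 1) / 6 * (real p + 1) * (x / (1 + K))"
    unfolding x_def using K by simp
  also have "\<dots> \<le> real m * (real p + 1) * (x / (1 + real Nn * x))"
  proof (intro mult_mono)
    show "x / (1 + K) \<le> x / (1 + real Nn * x)"
      using Nx x0 K by (intro divide_left_mono mult_pos_pos add_pos_nonneg) auto
  qed (use m6 x0 K in auto)
  also have "\<dots> = (\<Sum>ij\<in>?A. ?g x)"
    by (simp add: card_cartesian_product algebra_simps)
  also have "\<dots> \<le> (\<Sum>ij\<in>?A. ?g (traverse_prob \<alpha> p (f ij)))"
    using x0 by (intro sum_mono g_mono ge) auto
  also have "\<dots> = (\<Sum>s\<in>f ` ?A. ?g (traverse_prob \<alpha> p s))"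
    by (simp add: sum.reindex[OF inj])
  also have "\<dots> \<le> (\<Sum>s\<in>segments p. ?g (traverse_prob \<alpha> p s))"
    using sub by (intro sum_mono2 divide_nonneg_nonneg add_nonneg_nonneg mult_nonneg_nonneg traverse_prob_nonneg) auto
  finally show ?thesis .
qed

section \<open>Measurability of the observed data and of the target\<close>

abbreviation sample_algebra :: "nat \<Rightarrow> nat \<Rightarrow> sample measure" where
  "sample_algebra p Nn \<equiv> PiM {..<Nn} (\<lambda>_. count_space UNIV) \<Otimes>\<^sub>M (count_space UNIV \<Otimes>\<^sub>M
     (PiM (segments p) (\<lambda>_. borel) \<Otimes>\<^sub>M PiM {..<Nn} (\<lambda>_. PiM (segments p) (\<lambda>_. borel))))"

text \<open>The \<sigma>-algebra does not depend on the distributions, so measurability can be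
  proved on a fixed product space.\<close>

lemma sets_model:
  assumes "sets G = sets (PiM (segments p) (\<lambda>_. borel))"
  shows "sets (model \<alpha> p Nn \<mu> \<tau> G) = sets (sample_algebra p Nn)"
  unfolding model_def using assms by (intro sets_pair_measure_cong sets_PiM_cong) auto

lemma measurable_observe: "observe p Nn \<in> measurable (sample_algebra p Nn) (data_space p Nn)"
proof -
  have "(\<lambda>w. \<lambda>n\<in>{..<Nn}. \<lambda>s\<in>segments p. if s \<in> fst w n then fst (snd (snd w)) s + snd (snd (snd w)) n s else 0)
     \<in> measurable (sample_algebra p Nn) (PiM {..<Nn} (\<lambda>_. PiM (segments p) (\<lambda>_. borel)))"
  proof (intro measurable_restrict)
    fix n s assume n: "n \<in> {..<Nn}" and s: "s \<in> segments p"
    have [measurable]: "(\<lambda>w. fst w n) \<in> measurable (sample_algebra p Nn) (count_space UNIV)"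
      by (rule measurable_compose[OF measurable_fst measurable_component_singleton[OF n]])
    have P: "Measurable.pred (sample_algebra p Nn) (\<lambda>w. s \<in> fst w n)"
      by (rule measurable_compose[where f="\<lambda>w. fst w n" and N="count_space UNIV"]) auto
    have [measurable]: "(\<lambda>w. fst (snd (snd w)) s) \<in> borel_measurable (sample_algebra p Nn)"
      by (rule measurable_compose[OF measurable_compose[OF measurable_compose[OF measurable_snd measurable_snd] measurable_fst]
            measurable_component_singleton[OF s]])
    have m: "(\<lambda>w. snd (snd (snd w)) n) \<in> measurable (sample_algebra p Nn) (PiM (segments p) (\<lambda>_. borel))"
      by (rule measurable_compose[OF measurable_compose[OF measurable_compose[OF measurable_snd measurable_snd] measurable_snd]
            measurable_component_singleton[OF n]])
    have [measurable]: "(\<lambda>w. snd (snd (snd w)) n s) \<in> borel_measurable (sample_algebra p Nn)"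
      by (rule measurable_compose[OF m measurable_component_singleton[OF s]])
    show "(\<lambda>w. if s \<in> fst w n then fst (snd (snd w)) s + snd (snd (snd w)) n s else 0) \<in> borel_measurable (sample_algebra p Nn)"
      using P by (intro measurable_If) auto
  qed
  moreover have "(\<lambda>w. restrict (fst w) {..<Nn}) \<in> measurable (sample_algebra p Nn) (PiM {..<Nn} (\<lambda>_. count_space UNIV))"
    by (intro measurable_restrict measurable_compose[OF measurable_fst measurable_component_singleton]) auto
  ultimately show ?thesis
    unfolding data_space_def observe_def case_prod_beta'
    by (intro measurable_Pair) auto
qed

lemma measurable_route_sum:
  "(\<lambda>w. \<Sum>s\<in>fst (snd w). fst (snd (snd w)) s) \<in> borel_measurable (sample_algebra p Nn)"
proof -
  \<comment> \<open>The type of routes is uncountable, but the sum vanishes on infinite sets and there are only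
    countably many finite ones. Outside the segments \<open>\<theta>\<close> takes the constant value \<open>undefined\<close>.\<close>
  define fin where "fin y = (if finite y then y else {})" for y :: "seg set"
  have comp: "(\<lambda>w. fst (snd (snd w)) s) \<in> borel_measurable (sample_algebra p Nn)" for s
  proof (cases "s \<in> segments p")
    case True
    then show ?thesis
      by (rule measurable_compose[OF measurable_compose[OF measurable_compose[OF measurable_snd measurable_snd] measurable_fst]
            measurable_component_singleton])
  next
    case False
    have "(\<lambda>w. fst (snd (snd w)) s) \<in> borel_measurable (sample_algebra p Nn) \<longleftrightarrow>
       (\<lambda>w. undefined :: real) \<in> borel_measurable (sample_algebra p Nn)"
    proof (rule measurable_cong)
      fix w assume "w \<in> space (sample_algebra p Nn)"
      then have "fst (snd (snd w)) \<in> PiE (segments p) (\<lambda>_. UNIV)"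
        by (simp add: space_pair_measure mem_Times_iff space_PiM)
      then show "fst (snd (snd w)) s = undefined"
        using False by (rule PiE_arb)
    qed
    then show ?thesis by simp
  qed
  have "(\<lambda>w. fin (fst (snd w))) \<in> measurable (sample_algebra p Nn) (count_space (Collect finite))"
    by (rule measurable_compose[where f="\<lambda>w. fst (snd w)" and N="count_space UNIV"])
       (auto simp: fin_def)
  then have "(\<lambda>w. \<Sum>s\<in>fin (fst (snd w)). fst (snd (snd w)) s) \<in> borel_measurable (sample_algebra p Nn)"
    by (rule measurable_compose_countable'[where f="\<lambda>y w. \<Sum>s\<in>y. fst (snd (snd w)) s", rotated])
       (auto intro!: borel_measurable_sum comp countable_Collect_finite)
  moreover have "(\<Sum>s\<in>fin y. h s) = (\<Sum>s\<in>y. h s)" for y and h :: "seg \<Rightarrow> real"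
    by (simp add: fin_def)
  ultimately show ?thesis by simp
qed


section \<open>Integrated risk bounds\<close>

lemma (in gaussian_trips) observe_eq_obs:
  assumes "S = segments p"
  shows "observe p Nn (yh, y, w) = (restrict yh {..<Nn}, y, obs yh w)"
  by (cases w) (simp only: observe_def obs_def prod.case fst_conv snd_conv flip: assms cong del: restrict_cong)

text \<open>The bound for fixed routes is averaged first over the predicting route, which gives
  \<open>sparsity\<close>, and then over the history.\<close>

lemma seg_risk_le:
  assumes a: "0 < \<alpha>" "\<alpha> \<le> 1" and p: "p \<ge> 1" and tau: "\<tau> > 0"
    and sym: "\<And>s t. s \<in> segments p \<Longrightarrow> t \<in> segments p \<Longrightarrow> \<sigma> s t = \<sigma> t s"
    and gauss: "gaussian_vec (segments p) \<sigma> G"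
    and row: "\<And>s. s \<in> segments p \<Longrightarrow> (\<Sum>t\<in>segments p. \<bar>\<sigma> s t\<bar>) \<le> C" and C: "C \<ge> 0"
    and phi0: "\<And>s. \<phi> s 0 = 0"
    and phi: "\<And>s j. s \<in> segments p \<Longrightarrow> j \<ge> 1 \<Longrightarrow> \<bar>1 - \<phi> s j\<bar> \<le> A / sqrt (real j)" and A: "A \<ge> 0"
  shows "risk \<alpha> p Nn \<mu> \<tau> G (seg_est Nn \<mu> \<phi>)
    \<le> ennreal (2 * (\<tau>\<^sup>2 * (1 + A\<^sup>2) + C * (1 + A)\<^sup>2)) * (\<integral>\<^sup>+yh. ennreal (sparsity \<alpha> p Nn yh) \<partial>history \<alpha> p Nn)"
proof -
  interpret gaussian_trips "segments p" \<sigma> G Nn \<mu> \<tau>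
    using gauss tau sym by unfold_locales auto
  let ?K = "2 * (\<tau>\<^sup>2 * (1 + A\<^sup>2) + C * (1 + A)\<^sup>2)"
  let ?R = "measure_pmf (route_pmf \<alpha> p)"
  let ?F = "\<lambda>z. ennreal ((seg_est Nn \<mu> \<phi> (observe p Nn z) - (\<Sum>s\<in>fst (snd z). fst (snd (snd z)) s))\<^sup>2)"
  have K: "?K \<ge> 0" using C by (auto intro!: mult_nonneg_nonneg add_nonneg_nonneg)
  have sf: "sigma_finite_measure (?R \<Otimes>\<^sub>M Om)" "sigma_finite_measure Om"
    by (intro prob_space_imp_sigma_finite prob_space_pair measure_pmf.prob_space_axioms Om.prob_space_axioms)+
  have "risk \<alpha> p Nn \<mu> \<tau> G (seg_est Nn \<mu> \<phi>) = (\<integral>\<^sup>+z. ?F z \<partial>(history \<alpha> p Nn \<Otimes>\<^sub>M (?R \<Otimes>\<^sub>M Om)))"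
    by (simp add: risk_def model_def history_def Om_def)
  also have "\<dots> \<le> (\<integral>\<^sup>+yh. \<integral>\<^sup>+z. ?F (yh, z) \<partial>(?R \<Otimes>\<^sub>M Om) \<partial>history \<alpha> p Nn)"
    by (rule nn_integral_pair_le[OF sf(1)])
  also have "\<dots> \<le> (\<integral>\<^sup>+yh. \<integral>\<^sup>+y. \<integral>\<^sup>+w. ?F (yh, y, w) \<partial>Om \<partial>?R \<partial>history \<alpha> p Nn)"
    by (intro nn_integral_mono nn_integral_pair_le[OF sf(2)])
  also have "\<dots> \<le> (\<integral>\<^sup>+yh. ennreal ?K * ennreal (sparsity \<alpha> p Nn yh) \<partial>history \<alpha> p Nn)"
  proof (intro nn_integral_mono)
    fix yh
    have "(\<integral>\<^sup>+y. \<integral>\<^sup>+w. ?F (yh, y, w) \<partial>Om \<partial>?R)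
        \<le> (\<integral>\<^sup>+y. ennreal (\<Sum>s\<in>y. ?K * (1 / (1 + real (hist_count Nn yh s)))) \<partial>?R)"
    proof (intro nn_integral_mono_AE, unfold AE_measure_pmf_iff, rule ballI)
      fix y assume "y \<in> set_pmf (route_pmf \<alpha> p)"
      then have y: "y \<subseteq> segments p" by (rule set_route_pmf_subset[OF a p])
      show "(\<integral>\<^sup>+w. ?F (yh, y, w) \<partial>Om) \<le> ennreal (\<Sum>s\<in>y. ?K * (1 / (1 + real (hist_count Nn yh s))))"
        using seg_est_risk_le[OF y phi0 phi row C A, where yh=yh]
        by (simp only: observe_eq_obs[OF refl] fst_conv snd_conv sum_distrib_left)
    qed
    also have "\<dots> = ennreal (\<Sum>s\<in>segments p. traverse_prob \<alpha> p s * (?K * (1 / (1 + real (hist_count Nn yh s)))))"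
      using K by (intro nn_integral_route_sum[OF a p] mult_nonneg_nonneg) auto
    also have "\<dots> = ennreal (?K * sparsity \<alpha> p Nn yh)"
      unfolding sparsity_def sum_distrib_left by (rule arg_cong[where f=ennreal], intro sum.cong) auto
    also have "\<dots> = ennreal ?K * ennreal (sparsity \<alpha> p Nn yh)"
      using K sparsity_nonneg by (intro ennreal_mult) auto
    finally show "(\<integral>\<^sup>+y. \<integral>\<^sup>+w. ?F (yh, y, w) \<partial>Om \<partial>?R) \<le> ennreal ?K * ennreal (sparsity \<alpha> p Nn yh)" .
  qed
  also have "\<dots> = ennreal ?K * (\<integral>\<^sup>+yh. ennreal (sparsity \<alpha> p Nn yh) \<partial>history \<alpha> p Nn)"
    by (intro nn_integral_cmult) auto
  finally show ?thesis .
qed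

text \<open>The lower bound for fixed routes is averaged in the same order. Here the iterated
  integral has to equal the risk, so the integrand is shown measurable and Tonelli is used.\<close>

lemma risk_ge:
  assumes a: "0 < \<alpha>" "\<alpha> \<le> 1" and p: "p \<ge> 1" and tau: "\<tau> > 0"
    and sym: "\<And>s t. s \<in> segments p \<Longrightarrow> t \<in> segments p \<Longrightarrow> \<sigma> s t = \<sigma> t s"
    and gauss: "gaussian_vec (segments p) \<sigma> G"
    and inv1: "\<And>s u. s \<in> segments p \<Longrightarrow> u \<in> segments p \<Longrightarrow> (\<Sum>t\<in>segments p. \<sigma> s t * \<psi> t u) = (if s = u then 1 else 0)"
    and inv2: "\<And>s u. s \<in> segments p \<Longrightarrow> u \<in> segments p \<Longrightarrow> (\<Sum>t\<in>segments p. \<psi> s t * \<sigma> t u) = (if s = u then 1 else 0)"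
    and row: "\<And>s. s \<in> segments p \<Longrightarrow> (\<Sum>t\<in>segments p. \<bar>\<psi> s t\<bar>) \<le> C" and C: "C \<ge> 0"
    and g: "g \<in> borel_measurable (data_space p Nn)"
  shows "ennreal (1 / (1 / \<tau>\<^sup>2 + C)) * (\<integral>\<^sup>+yh. ennreal (sparsity \<alpha> p Nn yh) \<partial>history \<alpha> p Nn) \<le> risk \<alpha> p Nn \<mu> \<tau> G g"
proof -
  interpret gaussian_trips "segments p" \<sigma> G Nn \<mu> \<tau>
    using gauss tau sym by unfold_locales auto
  let ?c = "1 / (1 / \<tau>\<^sup>2 + C)"
  let ?R = "measure_pmf (route_pmf \<alpha> p)"
  let ?F = "\<lambda>z. ennreal ((g (observe p Nn z) - (\<Sum>s\<in>fst (snd z). fst (snd (snd z)) s))\<^sup>2)"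
  have tC: "1 / \<tau>\<^sup>2 + C > 0" using tau C by (intro add_pos_nonneg) auto
  interpret RO: prob_space "?R \<Otimes>\<^sub>M Om"
    by (intro prob_space_pair measure_pmf.prob_space_axioms Om.prob_space_axioms)
  have model: "model \<alpha> p Nn \<mu> \<tau> G = history \<alpha> p Nn \<Otimes>\<^sub>M (?R \<Otimes>\<^sub>M Om)"
    by (simp add: model_def history_def Om_def)
  have F: "?F \<in> borel_measurable (history \<alpha> p Nn \<Otimes>\<^sub>M (?R \<Otimes>\<^sub>M Om))"
    unfolding model[symmetric] measurable_cong_sets[OF sets_model[OF sets_G] refl]
    by (intro measurable_ennreal[THEN measurable_compose[rotated]] borel_measurable_power
          borel_measurable_diff measurable_route_sum measurable_compose[OF measurable_observe g])
  have "ennreal ?c * (\<integral>\<^sup>+yh. ennreal (sparsity \<alpha> p Nn yh) \<partial>history \<alpha> p Nn)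
      = (\<integral>\<^sup>+yh. ennreal ?c * ennreal (sparsity \<alpha> p Nn yh) \<partial>history \<alpha> p Nn)"
    by (intro nn_integral_cmult[symmetric]) auto
  also have "\<dots> \<le> (\<integral>\<^sup>+yh. \<integral>\<^sup>+z. ?F (yh, z) \<partial>(?R \<Otimes>\<^sub>M Om) \<partial>history \<alpha> p Nn)"
  proof (intro nn_integral_mono)
    fix yh assume yh: "yh \<in> space (history \<alpha> p Nn)"
    have Fyh: "(\<lambda>z. ?F (yh, z)) \<in> borel_measurable (?R \<Otimes>\<^sub>M Om)"
      using measurable_compose[OF measurable_Pair1'[OF yh] F] by simp
    have "ennreal ?c * ennreal (sparsity \<alpha> p Nn yh) = ennreal (?c * sparsity \<alpha> p Nn yh)"
      using tC sparsity_nonneg by (intro ennreal_mult[symmetric]) auto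
    also have "\<dots> = ennreal (\<Sum>s\<in>segments p. traverse_prob \<alpha> p s * (?c * (1 / (1 + real (hist_count Nn yh s)))))"
      unfolding sparsity_def sum_distrib_left by (rule arg_cong[where f=ennreal], intro sum.cong) auto
    also have "\<dots> = (\<integral>\<^sup>+y. ennreal (\<Sum>s\<in>y. ?c * (1 / (1 + real (hist_count Nn yh s)))) \<partial>?R)"
      using tC by (intro nn_integral_route_sum[OF a p, symmetric] mult_nonneg_nonneg) auto
    also have "\<dots> \<le> (\<integral>\<^sup>+y. \<integral>\<^sup>+w. ?F (yh, y, w) \<partial>Om \<partial>?R)"
    proof (intro nn_integral_mono_AE, unfold AE_measure_pmf_iff, rule ballI)
      fix y assume "y \<in> set_pmf (route_pmf \<alpha> p)"
      then have y: "y \<subseteq> segments p" by (rule set_route_pmf_subset[OF a p])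
      have k: "(\<lambda>T. g (restrict yh {..<Nn}, y, T)) \<in> borel_measurable (PiM {..<Nn} (\<lambda>_. PiM (segments p) (\<lambda>_. borel)))"
        by (rule measurable_compose[OF _ g]) (auto simp: data_space_def space_PiM)
      \<comment> \<open>Brings the denominators 1 / \<tau>^2 + C N_s to multiples of 1 + N_s, to
        match \<open>sparsity\<close>.\<close>
      have "?c * (1 / (1 + h)) \<le> 1 / (1 / \<tau>\<^sup>2 + C * h)" if "h \<ge> 0" for h :: real
      proof -
        have "0 < 1 / \<tau>\<^sup>2 + C * h" using tau C that by (intro add_pos_nonneg) auto
        moreover have "1 / \<tau>\<^sup>2 + C * h \<le> (1 / \<tau>\<^sup>2 + C) * (1 + h)"
        proof -
          have "(1 / \<tau>\<^sup>2 + C) * (1 + h) = 1 / \<tau>\<^sup>2 + C * h + (h / \<tau>\<^sup>2 + C)"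
            by (simp add: algebra_simps add_divide_distrib)
          then show ?thesis using C that by simp
        qed
        ultimately have "1 / ((1 / \<tau>\<^sup>2 + C) * (1 + h)) \<le> 1 / (1 / \<tau>\<^sup>2 + C * h)"
          by (intro frac_le) auto
        then show ?thesis by simp
      qed
      then have "ennreal (\<Sum>s\<in>y. ?c * (1 / (1 + real (hist_count Nn yh s))))
         \<le> ennreal (\<Sum>s\<in>y. 1 / (1 / \<tau>\<^sup>2 + C * real (hist_count Nn yh s)))"
        by (intro ennreal_leI sum_mono) auto
      also have "\<dots> \<le> (\<integral>\<^sup>+w. ennreal ((g (restrict yh {..<Nn}, y, obs yh w) - (\<Sum>s\<in>y. fst w s))\<^sup>2) \<partial>Om)"
        by (rule bayes_risk_ge[OF y k inv1 inv2 row C])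
      finally show "ennreal (\<Sum>s\<in>y. ?c * (1 / (1 + real (hist_count Nn yh s)))) \<le> (\<integral>\<^sup>+w. ?F (yh, y, w) \<partial>Om)"
        by (simp only: observe_eq_obs[OF refl] fst_conv snd_conv)
    qed
    also have "\<dots> = (\<integral>\<^sup>+z. ?F (yh, z) \<partial>(?R \<Otimes>\<^sub>M Om))"
      by (rule Om.nn_integral_fst[OF Fyh])
    finally show "ennreal ?c * ennreal (sparsity \<alpha> p Nn yh) \<le> (\<integral>\<^sup>+z. ?F (yh, z) \<partial>(?R \<Otimes>\<^sub>M Om))" .
  qed
  also have "\<dots> = (\<integral>\<^sup>+z. ?F z \<partial>(history \<alpha> p Nn \<Otimes>\<^sub>M (?R \<Otimes>\<^sub>M Om)))"
    by (rule RO.nn_integral_fst[OF F])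
  also have "\<dots> = risk \<alpha> p Nn \<mu> \<tau> G g"
    by (simp add: risk_def model)
  finally show ?thesis .
qed

section \<open>Comparison of the risks and the positive limit inferior\<close>

theorem theorem3p2:
  fixes \<alpha> \<mu> \<tau> :: real
    and N :: "nat \<Rightarrow> nat"
    and \<sigma> \<psi> :: "nat \<Rightarrow> seg \<Rightarrow> seg \<Rightarrow> real"
    and G :: "nat \<Rightarrow> (seg \<Rightarrow> real) measure"
  assumes alpha: "0 < \<alpha>" "\<alpha> \<le> 1"
    and tau: "\<tau> > 0"
    and N_lim: "filterlim N at_top sequentially"
    and sym: "\<And>p s t. s \<in> segments p \<Longrightarrow> t \<in> segments p \<Longrightarrow> \<sigma> p s t = \<sigma> p t s"
    and inv1: "\<And>p s u. s \<in> segments p \<Longrightarrow> u \<in> segments p \<Longrightarrow>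
                 (\<Sum>t\<in>segments p. \<sigma> p s t * \<psi> p t u) = (if s = u then 1 else 0)"
    and inv2: "\<And>p s u. s \<in> segments p \<Longrightarrow> u \<in> segments p \<Longrightarrow>
                 (\<Sum>t\<in>segments p. \<psi> p s t * \<sigma> p t u) = (if s = u then 1 else 0)"
    and gauss: "\<And>p. gaussian_vec (segments p) (\<sigma> p) (G p)"
    and sigma_bdd: "\<exists>C. \<forall>p. \<forall>s\<in>segments p. (\<Sum>t\<in>segments p. \<bar>\<sigma> p s t\<bar>) \<le> C"
    and psi_bdd: "\<exists>C. \<forall>p. \<forall>s\<in>segments p. (\<Sum>t\<in>segments p. \<bar>\<psi> p s t\<bar>) \<le> C"
    and sigma_min: "\<exists>\<sigma>min > 0. \<forall>p. \<forall>y\<in>routes p. (\<Sum>s\<in>y. \<Sum>t\<in>y. \<sigma> p s t) \<ge> \<sigma>min"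
  shows
    "(1/2 \<le> \<alpha> \<and> (\<lambda>p. real (N p)) \<in> \<omega>(\<lambda>p. real p) \<longrightarrow>
       (\<forall>\<phi> :: nat \<Rightarrow> seg \<Rightarrow> nat \<Rightarrow> real.
          (\<forall>p s. \<phi> p s 0 = 0) \<and>
          (\<exists>C. \<forall>p. \<forall>s\<in>segments p. \<forall>k\<ge>1. \<bar>1 - \<phi> p s k\<bar> \<le> C / sqrt (real k)) \<longrightarrow>
          (\<exists>C. \<forall>\<^sub>F p in sequentially.
              risk \<alpha> p (N p) \<mu> \<tau> (G p) (seg_est (N p) \<mu> (\<phi> p))
                \<le> ennreal (C * ln (real p)) * opt_risk \<alpha> p (N p) \<mu> \<tau> (G p))))
     \<and>
     ((\<lambda>p. real (N p)) \<in> O(\<lambda>p. real p) \<longrightarrow>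
       (\<forall>g :: nat \<Rightarrow> data \<Rightarrow> real.
          (\<forall>p. g p \<in> borel_measurable (data_space p (N p))) \<longrightarrow>
          liminf (\<lambda>p. risk \<alpha> p (N p) \<mu> \<tau> (G p) (g p)) > 0))"
proof -
  obtain C1' where "\<And>p s. s \<in> segments p \<Longrightarrow> (\<Sum>t\<in>segments p. \<bar>\<sigma> p s t\<bar>) \<le> C1'"
    using sigma_bdd by auto
  then obtain C1 where C1: "C1 \<ge> 0" "\<And>p s. s \<in> segments p \<Longrightarrow> (\<Sum>t\<in>segments p. \<bar>\<sigma> p s t\<bar>) \<le> C1"
    by (meson max.coboundedI1 max.cobounded2)
  obtain C2' where "\<And>p s. s \<in> segments p \<Longrightarrow> (\<Sum>t\<in>segments p. \<bar>\<psi> p s t\<bar>) \<le> C2'"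
    using psi_bdd by auto
  then obtain C2 where C2: "C2 \<ge> 0" "\<And>p s. s \<in> segments p \<Longrightarrow> (\<Sum>t\<in>segments p. \<bar>\<psi> p s t\<bar>) \<le> C2"
    by (meson max.coboundedI1 max.cobounded2)
  define c where "c = 1 / (1 / \<tau>\<^sup>2 + C2)"
  have c: "c > 0" unfolding c_def using tau C2(1) by (auto intro!: divide_pos_pos add_pos_nonneg)
  \<comment> \<open>The common yardstick: segment-based risks are at most a constant times
    \<open>J p\<close>, and every risk is at least \<open>c * J p\<close>.\<close>
  define J where "J p = (\<integral>\<^sup>+yh. ennreal (sparsity \<alpha> p (N p) yh) \<partial>history \<alpha> p (N p))" for p
  have lower: "ennreal c * J p \<le> risk \<alpha> p (N p) \<mu> \<tau> (G p) g"
    if "p \<ge> 1" "g \<in> borel_measurable (data_space p (N p))" for p g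
    unfolding c_def J_def
    by (rule risk_ge[OF alpha that(1) tau sym gauss inv1 inv2 C2(2,1) that(2)])
  show ?thesis
  proof (intro conjI impI allI)
    fix \<phi> :: "nat \<Rightarrow> seg \<Rightarrow> nat \<Rightarrow> real"
    assume "(\<forall>p s. \<phi> p s 0 = 0) \<and>
          (\<exists>C. \<forall>p. \<forall>s\<in>segments p. \<forall>k\<ge>1. \<bar>1 - \<phi> p s k\<bar> \<le> C / sqrt (real k))"
    then obtain A' where phi0: "\<And>p s. \<phi> p s 0 = 0"
      and phi': "\<And>p s k. s \<in> segments p \<Longrightarrow> k \<ge> 1 \<Longrightarrow> \<bar>1 - \<phi> p s k\<bar> \<le> A' / sqrt (real k)" by blast
    define A where "A = max A' 0"
    have phi: "\<bar>1 - \<phi> p s k\<bar> \<le> A / sqrt (real k)" if "s \<in> segments p" "k \<ge> 1" for p s k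
      using phi'[OF that] by (rule order_trans) (auto simp: A_def intro!: divide_right_mono)
    have A: "A \<ge> 0" by (simp add: A_def)
    define K where "K = 2 * (\<tau>\<^sup>2 * (1 + A\<^sup>2) + C1 * (1 + A)\<^sup>2)"
    have K: "K \<ge> 0" unfolding K_def using C1(1) by (auto intro!: mult_nonneg_nonneg add_nonneg_nonneg)
    have "risk \<alpha> p (N p) \<mu> \<tau> (G p) (seg_est (N p) \<mu> (\<phi> p))
                \<le> ennreal (K / c * ln (real p)) * opt_risk \<alpha> p (N p) \<mu> \<tau> (G p)" if p: "p \<ge> 3" for p
    proof -
      \<comment> \<open>The ratio of the risks is at most K / c; from p = 3 \<ge> exp 1 on, the
        logarithm only enlarges this bound.\<close>
      have "1 \<le> ln (real p)"
        using p exp_le by (subst ln_ge_iff) (auto intro: order_trans)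
      then have l: "K / c \<le> K / c * ln (real p)" using mult_left_mono[of 1 "ln (real p)" "K / c"] K c by simp
      have "risk \<alpha> p (N p) \<mu> \<tau> (G p) (seg_est (N p) \<mu> (\<phi> p)) \<le> ennreal K * J p"
        unfolding K_def J_def
        by (rule seg_risk_le[OF alpha _ tau sym gauss C1(2,1) phi0 phi A]) (use p in auto)
      also have "\<dots> = ennreal (K / c) * (ennreal c * J p)"
      proof -
        have "ennreal K = ennreal (K / c) * ennreal c"
          using K c by (subst ennreal_mult[symmetric]) auto
        then show ?thesis by (simp only: mult.assoc)
      qed
      also have "\<dots> \<le> ennreal (K / c * ln (real p)) * (ennreal c * J p)"
        by (intro mult_right_mono ennreal_leI l) auto
      \<comment> \<open>\<open>lower\<close> holds uniformly over measurable estimators, so it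
        passes to the infimum.\<close>
      also have "\<dots> \<le> ennreal (K / c * ln (real p)) * opt_risk \<alpha> p (N p) \<mu> \<tau> (G p)"
        unfolding opt_risk_def using p by (intro mult_left_mono INF_greatest lower) auto
      finally show ?thesis .
    qed
    then show "\<exists>C. \<forall>\<^sub>F p in sequentially.
              risk \<alpha> p (N p) \<mu> \<tau> (G p) (seg_est (N p) \<mu> (\<phi> p))
                \<le> ennreal (C * ln (real p)) * opt_risk \<alpha> p (N p) \<mu> \<tau> (G p)"
      unfolding eventually_sequentially by blast
  next
    fix g :: "nat \<Rightarrow> data \<Rightarrow> real"
    assume O: "(\<lambda>p. real (N p)) \<in> O(\<lambda>p. real p)"
      and g: "\<forall>p. g p \<in> borel_measurable (data_space p (N p))"
    from O obtain K where K: "K > 0" and ev: "\<forall>\<^sub>F p in sequentially. norm (real (N p)) \<le> K * norm (real p)"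
      by (elim landau_o.bigE)
    \<comment> \<open>The comparison constant times the lower bound of
      \<open>sum_traverse_prob_ge\<close>; it is free of p.\<close>
    define d where "d = c * (\<alpha>^8 / (216 * (1 + K)))"
    have d: "d > 0" unfolding d_def using c alpha K by simp
    have "\<forall>\<^sub>F p in sequentially. ennreal d \<le> risk \<alpha> p (N p) \<mu> \<tau> (G p) (g p)"
      using ev eventually_ge_at_top[of 3]
    proof eventually_elim
      case (elim p)
      have "ennreal (\<alpha>^8 / (216 * (1 + K)))
         \<le> ennreal (\<Sum>s\<in>segments p. traverse_prob \<alpha> p s / (1 + real (N p) * traverse_prob \<alpha> p s))"
        using elim K by (intro ennreal_leI sum_traverse_prob_ge[OF alpha]) auto
      also have "\<dots> \<le> J p" unfolding J_def by (rule expectation_sparsity_ge)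
      finally have "ennreal c * ennreal (\<alpha>^8 / (216 * (1 + K))) \<le> ennreal c * J p"
        by (intro mult_left_mono) auto
      also have "\<dots> \<le> risk \<alpha> p (N p) \<mu> \<tau> (G p) (g p)"
        using elim g by (intro lower) auto
      finally show ?case
        unfolding d_def using c alpha K by (subst ennreal_mult) auto
    qed
    then have "ennreal d \<le> liminf (\<lambda>p. risk \<alpha> p (N p) \<mu> \<tau> (G p) (g p))"
      by (rule Liminf_bounded)
    moreover have "0 < ennreal d" using d by simp
    ultimately show "0 < liminf (\<lambda>p. risk \<alpha> p (N p) \<mu> \<tau> (G p) (g p))"
      by (rule less_le_trans[rotated])
  qed
qed

end
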